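(* Let $\mathbb{K}$ be a field and let $C$ be a component module (over $\mathbb{K}$) over a partially ordered set $P$ with a minimal generator. Then there is a unique decomposition $$C = S\oplus I,$$ where $S$ is a semi-component module over $P$ and $I$ is an interval module over $P$. In particular, $C$ is the component extension of $S$ at $p$ for some choice of position $p\in P$ of the minimal generator.
   Context: A partially ordered set $P$ is viewed as a category with one object for each element and a unique morphism $p\to q$ whenever $p\le q$. A persistence module over $P$ is a functor from $P$ to the category of finite-dimensional $\mathbb{K}$-vector spaces and linear maps. Direct sums are taken objectwise. A persistence module $M$ over $P$ is an interval module if: (1) for every $p\in P$ the vector space $M(p)$ is isomorphic to $\mathbb{K}$ or $0$; (2) for all morphisms $\alpha\colon q\to p$ in $P$ with $M(q)\cong M(p)\cong\mathbb{K}$, the linear maps $M(\alpha)$ can, with respect to some basis, be chosen simultaneously as the identity; (3) for morphisms $\alpha\colon q\to p$ and $\beta\colon p\to l$ in $P$, if $M(q)\cong M(l)\cong\mathbb{K}$ then $M(p)\cong\mathbb{K}$. A persistence module $M$ over $P$ is a component module if there is a basis of every vector space $M(q)$, $q\in P$ (together called a component basis of $M$), such that for every morphism $\alpha\colon q\to r$ in $P$ the matrix of $M(\alpha)$ with respect to these bases contains only zeros and ones, with exactly one $1$ in each column. If instead the matrices contain only zeros and ones with at most one $1$ in each column, $M$ is called a semi-component module and the bases a semi-component basis. An element of the (semi-)component basis in $M(q)$ is called a generator if it is not in the image of $M(\alpha)$ for any non-identity morphism $\alpha\colon r\to q$ in $P$. The module $M$ has a minimal generator, with position $p\in P$, if there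 is at least one generator in $M(p)$ and there is a morphism $p\to q$ in $P$ for every $q\in P$ such that $M(q)$ contains a generator. Component extension at $p$: let $S$ be a semi-component module with a choice of semi-component basis, and let $p\in P$ be such that every generator of $S$ lies in some $S(q)$ with $p\le q$. The component extension of $S$ at $p$ is the component module obtained from $S$ by leaving the vector space zero at every $s\not\ge p$, adding one extra dimension to $S(r)$ for every $r\ge p$, and, for $p\le q\le r$, adding to the matrix of $S(q)\to S(r)$ a new first column and a new first row: the new first column has $1$ as its first entry and zeros otherwise; after its first entry, the new first row has entry $0$ in each column that already contains a $1$, and entry $1$ in each other column.
   Formalization: Added: basis elements not coming from any generator lie above p (else C may be nonzero off p's up-set). Uniqueness is up to isomorphism, only among decompositions where I is supported exactly on all q ≥ p or C is a component extension of S; C = C⊕0 breaks the literal claim. *)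

theory Defs
  imports Complex_Main "HOL-Library.Product_Plus"
begin

text \<open>
  A functor from a poset (the order of the type \<open>'p\<close>) to vector spaces over the field \<open>'k\<close>.  The
  space at \<open>q\<close> is a subspace of one vector space \<open>'v\<close> with scalar multiplication \<open>scl\<close>.  This is no
  loss of generality: the spaces of any functor embed into their direct sum.  The value \<open>tr M q r\<close>
  is meaningful only for \<open>q \<le> r\<close> and on \<open>spc M q\<close>.
\<close>

record ('p, 'k, 'v) pmod =
  scl :: "'k \<Rightarrow> 'v \<Rightarrow> 'v"
  spc :: "'p \<Rightarrow> 'v set"
  tr :: "'p \<Rightarrow> 'p \<Rightarrow> 'v \<Rightarrow> 'v"

definition lin_map ::
  "('k::field \<Rightarrow> 'v::ab_group_add \<Rightarrow> 'v) \<Rightarrow> 'v set \<Rightarrow>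
   ('k \<Rightarrow> 'w::ab_group_add \<Rightarrow> 'w) \<Rightarrow> 'w set \<Rightarrow> ('v \<Rightarrow> 'w) \<Rightarrow> bool" where
  "lin_map s V t W f \<longleftrightarrow>
     (\<forall>x\<in>V. f x \<in> W) \<and>
     (\<forall>x\<in>V. \<forall>y\<in>V. f (x + y) = f x + f y) \<and>
     (\<forall>a. \<forall>x\<in>V. f (s a x) = t a (f x))"

definition persistence_module :: "('p::order, 'k::field, 'v::ab_group_add) pmod \<Rightarrow> bool" where
  "persistence_module M \<longleftrightarrow>
     vector_space (scl M) \<and>
     (\<forall>q. module.subspace (scl M) (spc M q)) \<and>
     (\<forall>q. \<exists>A. finite A \<and> module.span (scl M) A = spc M q) \<and>
     (\<forall>q r. q \<le> r \<longrightarrow> lin_map (scl M) (spc M q) (scl M) (spc M r) (tr M q r)) \<and>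
     (\<forall>q. \<forall>x\<in>spc M q. tr M q q x = x) \<and>
     (\<forall>q r t. q \<le> r \<and> r \<le> t \<longrightarrow> (\<forall>x\<in>spc M q. tr M r t (tr M q r x) = tr M q t x))"

definition pmod_iso ::
  "('p::order, 'k::field, 'v::ab_group_add) pmod \<Rightarrow> ('p, 'k, 'w::ab_group_add) pmod \<Rightarrow> bool" where
  "pmod_iso M N \<longleftrightarrow>
     (\<exists>f. (\<forall>q. lin_map (scl M) (spc M q) (scl N) (spc N q) (f q) \<and>
               bij_betw (f q) (spc M q) (spc N q)) \<and>
          (\<forall>q r. q \<le> r \<longrightarrow> (\<forall>x\<in>spc M q. f r (tr M q r x) = tr N q r (f q x))))"

definition pmod_sum ::
  "('p, 'k, 'v) pmod \<Rightarrow> ('p, 'k, 'w) pmod \<Rightarrow> ('p, 'k, 'v \<times> 'w) pmod" where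
  "pmod_sum M N =
     \<lparr>scl = (\<lambda>a (x, y). (scl M a x, scl N a y)),
      spc = (\<lambda>q. spc M q \<times> spc N q),
      tr = (\<lambda>q r (x, y). (tr M q r x, tr N q r y))\<rparr>"

definition iso_field_at :: "('p, 'k::field, 'v::ab_group_add) pmod \<Rightarrow> 'p \<Rightarrow> bool" where
  "iso_field_at M q \<longleftrightarrow>
     (\<exists>f. lin_map (*) (UNIV :: 'k set) (scl M) (spc M q) f \<and> bij_betw f UNIV (spc M q))"

text \<open>
  As in the source, the support of an interval module need not be connected and may be empty.  In
  the second condition \<open>e q\<close> is the basis vector chosen for the one-dimensional space at \<open>q\<close>.
\<close>

definition interval_module :: "('p::order, 'k::field, 'v::ab_group_add) pmod \<Rightarrow> bool" where
  "interval_module M \<longleftrightarrow>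
     persistence_module M \<and>
     (\<forall>q. iso_field_at M q \<or> spc M q = {0}) \<and>
     (\<exists>e. (\<forall>q. iso_field_at M q \<longrightarrow> e q \<noteq> 0 \<and> module.span (scl M) {e q} = spc M q) \<and>
          (\<forall>q r. q \<le> r \<and> iso_field_at M q \<and> iso_field_at M r \<longrightarrow> tr M q r (e q) = e r)) \<and>
     (\<forall>q r t. q \<le> r \<and> r \<le> t \<and> iso_field_at M q \<and> iso_field_at M t \<longrightarrow> iso_field_at M r)"

definition basis_family ::
  "('p, 'k::field, 'v::ab_group_add) pmod \<Rightarrow> ('p \<Rightarrow> 'v set) \<Rightarrow> bool" where
  "basis_family M B \<longleftrightarrow>
     (\<forall>q. \<not> module.dependent (scl M) (B q) \<and> module.span (scl M) (B q) = spc M q)"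

text \<open>
  Matrices are indexed by the basis vectors themselves: this is the entry in row \<open>c \<in> B r\<close> and
  column \<open>b \<in> B q\<close> of the matrix of \<open>tr M q r\<close>.
\<close>

definition entry ::
  "('p, 'k::field, 'v::ab_group_add) pmod \<Rightarrow> ('p \<Rightarrow> 'v set) \<Rightarrow> 'p \<Rightarrow> 'p \<Rightarrow> 'v \<Rightarrow> 'v \<Rightarrow> 'k" where
  "entry M B q r c b = module.representation (scl M) (B r) (tr M q r b) c"

definition component_basis ::
  "('p::order, 'k::field, 'v::ab_group_add) pmod \<Rightarrow> ('p \<Rightarrow> 'v set) \<Rightarrow> bool" where
  "component_basis M B \<longleftrightarrow>
     persistence_module M \<and> basis_family M B \<and>
     (\<forall>q r. q \<le> r \<longrightarrow>
        (\<forall>b\<in>B q. (\<forall>c\<in>B r. entry M B q r c b \<in> {0, 1}) \<and>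
                 (\<exists>!c. c \<in> B r \<and> entry M B q r c b = 1)))"

definition semi_component_basis ::
  "('p::order, 'k::field, 'v::ab_group_add) pmod \<Rightarrow> ('p \<Rightarrow> 'v set) \<Rightarrow> bool" where
  "semi_component_basis M B \<longleftrightarrow>
     persistence_module M \<and> basis_family M B \<and>
     (\<forall>q r. q \<le> r \<longrightarrow>
        (\<forall>b\<in>B q. (\<forall>c\<in>B r. entry M B q r c b \<in> {0, 1}) \<and>
                 (\<exists>\<^sub>\<le>\<^sub>1 c. c \<in> B r \<and> entry M B q r c b = 1)))"

definition component_module :: "('p::order, 'k::field, 'v::ab_group_add) pmod \<Rightarrow> bool" where
  "component_module M \<longleftrightarrow> (\<exists>B. component_basis M B)"

definition semi_component_module :: "('p::order, 'k::field, 'v::ab_group_add) pmod \<Rightarrow> bool" where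
  "semi_component_module M \<longleftrightarrow> (\<exists>B. semi_component_basis M B)"

definition generator ::
  "('p::order, 'k, 'v) pmod \<Rightarrow> ('p \<Rightarrow> 'v set) \<Rightarrow> 'p \<Rightarrow> 'v \<Rightarrow> bool" where
  "generator M B q b \<longleftrightarrow> b \<in> B q \<and> (\<forall>r<q. b \<notin> tr M r q ` spc M r)"

definition minimal_generator_position ::
  "('p::order, 'k, 'v) pmod \<Rightarrow> ('p \<Rightarrow> 'v set) \<Rightarrow> 'p \<Rightarrow> bool" where
  "minimal_generator_position M B p \<longleftrightarrow>
     (\<exists>g. generator M B p g) \<and> (\<forall>q g. generator M B q g \<longrightarrow> p \<le> q)"

definition from_generator ::
  "('p::order, 'k, 'v) pmod \<Rightarrow> ('p \<Rightarrow> 'v set) \<Rightarrow> 'p \<Rightarrow> 'v \<Rightarrow> bool" where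
  "from_generator M B q b \<longleftrightarrow> (\<exists>r g. r \<le> q \<and> generator M B r g \<and> tr M r q g = b)"

text \<open>
  If the order is well-founded, for instance if the poset is finite, every element of a component
  basis comes from a generator.
\<close>

lemma component_basis_tr:
  assumes cb: "component_basis M B" and qr: "q \<le> r" and b: "b \<in> B q"
  shows "tr M q r b \<in> B r"
proof -
  interpret vector_space "scl M"
    using cb by (simp add: component_basis_def persistence_module_def)
  have bf: "basis_family M B" using cb by (simp add: component_basis_def)
  have ind: "independent (B r)" and spr: "span (B r) = spc M r" and spq: "span (B q) = spc M q"
    using bf by (simp_all add: basis_family_def)
  have bq: "b \<in> spc M q" using span_base[OF b] spq by simp
  have ty: "tr M q r b \<in> span (B r)"
  proof -
    have "lin_map (scl M) (spc M q) (scl M) (spc M r) (tr M q r)"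
      using cb qr by (simp add: component_basis_def persistence_module_def)
    then show ?thesis using bq spr by (simp add: lin_map_def)
  qed
  obtain c where c: "c \<in> B r" "entry M B q r c b = 1"
    and u: "\<And>d. d \<in> B r \<Longrightarrow> entry M B q r d b = 1 \<Longrightarrow> d = c"
    and z: "\<And>d. d \<in> B r \<Longrightarrow> entry M B q r d b \<in> {0, 1}"
  proof -
    have "\<forall>c\<in>B r. entry M B q r c b \<in> {0, 1}" "\<exists>!c. c \<in> B r \<and> entry M B q r c b = 1"
      using cb qr b by (simp_all add: component_basis_def)
    then show ?thesis using that by blast
  qed
  have nz: "{d. representation (B r) (tr M q r b) d \<noteq> 0} = {c}"
  proof (intro set_eqI iffI)
    fix d assume "d \<in> {d. representation (B r) (tr M q r b) d \<noteq> 0}"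
    then have d: "representation (B r) (tr M q r b) d \<noteq> 0" by simp
    then have dr: "d \<in> B r" by (rule representation_ne_zero)
    then show "d \<in> {c}" using z[OF dr] u[OF dr] d by (auto simp: entry_def)
  next
    fix d assume "d \<in> {c}"
    then show "d \<in> {d. representation (B r) (tr M q r b) d \<noteq> 0}"
      using c(2) by (simp add: entry_def)
  qed
  have "(\<Sum>d | representation (B r) (tr M q r b) d \<noteq> 0.
           scl M (representation (B r) (tr M q r b) d) d) = tr M q r b"
    by (rule sum_nonzero_representation_eq[OF ind ty])
  then have "scl M 1 c = tr M q r b"
    using c(2) unfolding nz by (simp add: entry_def)
  then show ?thesis using c(1) by simp
qed

lemma from_generator_if_wfp:
  fixes M :: "('p::order, 'k::field, 'v::ab_group_add) pmod"
  assumes wf: "wfp ((<) :: 'p \<Rightarrow> 'p \<Rightarrow> bool)" and cb: "component_basis M B"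
  shows "b \<in> B q \<Longrightarrow> from_generator M B q b"
proof (induction q arbitrary: b rule: wfp_induct_rule[OF wf])
  case (1 q)
  interpret vector_space "scl M"
    using cb by (simp add: component_basis_def persistence_module_def)
  have pm: "persistence_module M" using cb by (simp add: component_basis_def)
  have bf: "basis_family M B" using cb by (simp add: component_basis_def)
  have sp: "span (B t) = spc M t" for t
    using bf by (simp add: basis_family_def)
  show ?case
  proof (cases "generator M B q b")
    case True
    have "b \<in> spc M q" using span_base[OF 1(2)] sp by simp
    then have "tr M q q b = b" using pm by (simp add: persistence_module_def)
    then show ?thesis using True unfolding from_generator_def by blast
  next
    case False
    then obtain r x where r: "r < q" and x: "x \<in> spc M r" and e: "tr M r q x = b"
      using 1(2) by (auto simp: generator_def)
    have lin: "lin_map (scl M) (spc M r) (scl M) (spc M q) (tr M r q)"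
      using pm r by (simp add: persistence_module_def)
    have "\<exists>c\<in>B r. tr M r q c = b"
    proof (rule ccontr)
      assume no: "\<not> ?thesis"
      have "x \<in> span (B r)" using x sp by simp
      then have "x \<in> span (B r) \<and> tr M r q x \<in> span (B q - {b})"
      proof (induction rule: span_induct_alt)
        case base
        have "0 \<in> spc M r" using span_zero[of "B r"] sp by simp
        then have "tr M r q (0 + 0) = tr M r q 0 + tr M r q 0"
          using lin by (simp only: lin_map_def)
        then have "tr M r q 0 = 0" by simp
        then show ?case by (simp add: span_zero)
      next
        case (step a c y)
        have c: "c \<in> spc M r" "scl M a c \<in> spc M r" and y: "y \<in> spc M r"
          using step sp[of r] span_base[of c "B r"] span_scale[of c "B r" a] by simp_all
        have "tr M r q (scl M a c + y) = scl M a (tr M r q c) + tr M r q y"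
          using lin c y by (simp add: lin_map_def)
        moreover have "tr M r q c \<in> span (B q - {b})"
          using component_basis_tr[OF cb less_imp_le[OF r] step(1)] step(1) no
          by (intro span_base) auto
        ultimately have "tr M r q (scl M a c + y) \<in> span (B q - {b})"
          using step by (simp add: span_add span_scale)
        moreover have "scl M a c + y \<in> span (B r)"
          using c(2) y sp[of r] span_add[of _ "B r"] by simp
        ultimately show ?case by simp
      qed
      then have "dependent (B q)" using e 1(2) unfolding dependent_def by blast
      then show False using bf by (simp add: basis_family_def)
    qed
    then obtain c where c: "c \<in> B r" "tr M r q c = b" by blast
    obtain t g where t: "t \<le> r" "generator M B t g" "tr M t r g = c"
      using 1(1)[OF r c(1)] unfolding from_generator_def by blast
    have "g \<in> B t" using t(2) by (simp add: generator_def)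
    then have g: "g \<in> spc M t" using span_base[of g "B t"] sp by simp
    have "tr M t q g = b"
    proof -
      have "\<forall>q r s. q \<le> r \<and> r \<le> s \<longrightarrow> (\<forall>x\<in>spc M q. tr M r s (tr M q r x) = tr M q s x)"
        using pm by (simp add: persistence_module_def)
      with t(1) less_imp_le[OF r] g have "tr M r q (tr M t r g) = tr M t q g"
        by blast
      then show ?thesis using t(3) c(2) by simp
    qed
    moreover have "t \<le> q" using t(1) r by order
    ultimately show ?thesis
      using t(2) unfolding from_generator_def by blast
  qed
qed

text \<open>
  The component extension.  The first factor \<open>'k\<close> of the product is the coordinate of the added
  basis vector \<open>(1, 0)\<close>, and \<open>new_row\<close> is the new first row after its first entry.  The new first
  column appears as the summand \<open>a\<close> in the first coordinate.
\<close>

definition new_row ::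
  "('p, 'k::field, 'v::ab_group_add) pmod \<Rightarrow> ('p \<Rightarrow> 'v set) \<Rightarrow> 'p \<Rightarrow> 'p \<Rightarrow> 'v \<Rightarrow> 'k" where
  "new_row S B q r b = (if \<exists>c\<in>B r. entry S B q r c b = 1 then 0 else 1)"

definition component_extension ::
  "('p::order, 'k::field, 'v::ab_group_add) pmod \<Rightarrow> ('p \<Rightarrow> 'v set) \<Rightarrow> 'p \<Rightarrow> ('p, 'k, 'k \<times> 'v) pmod"
  where
  "component_extension S B p =
     \<lparr>scl = (\<lambda>a (x, v). (a * x, scl S a v)),
      spc = (\<lambda>r. if p \<le> r then UNIV \<times> spc S r else {0}),
      tr = (\<lambda>q r (a, v).
              (a + (\<Sum>b\<in>B q. new_row S B q r b * module.representation (scl S) (B q) v b),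
               tr S q r v))\<rparr>"

text \<open>
  The component extension at \<open>p\<close> leaves the space at each \<open>s\<close> not above \<open>p\<close> zero, which presupposes
  that \<open>S\<close> is zero there.  The condition on generators alone does not give this if the poset has
  infinite descending chains.
\<close>

definition is_component_extension ::
  "('p::order, 'k::field, 'w::ab_group_add) pmod \<Rightarrow> ('p, 'k, 'v::ab_group_add) pmod \<Rightarrow>
   ('p \<Rightarrow> 'v set) \<Rightarrow> 'p \<Rightarrow> bool" where
  "is_component_extension C S B p \<longleftrightarrow>
     semi_component_basis S B \<and>
     (\<forall>q g. generator S B q g \<longrightarrow> p \<le> q) \<and>
     (\<forall>s. \<not> p \<le> s \<longrightarrow> spc S s = {0}) \<and>
     pmod_iso C (component_extension S B p)"

end

theory Submission
  imports Defs
begin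

text \<open>
  Let \<open>g\<close> be a generator at the minimal position \<open>p\<close>, and let \<open>base q\<close> be its image in the space at
  \<open>q\<close>.  Every basis vector lies above \<open>p\<close>, and transition maps carry basis vectors to basis vectors.
  Hence the vectors \<open>base q\<close> span an interval submodule \<open>I\<close> (\<open>base_line\<close>) with support
  \<open>{q. p \<le> q}\<close>, and the sum of the coordinates, the augmentation, commutes with the transition maps
  (\<open>aug_tr\<close>).  The augmentation is 1 on \<open>base q\<close>, so its kernel \<open>S\<close> (\<open>aug_kernel\<close>) is a complement of
  \<open>I\<close>.  The differences \<open>b - base q\<close>, for basis vectors \<open>b \<noteq> base q\<close>, form a basis of \<open>S\<close>, and each of
  them is sent to another one or, if \<open>b\<close> and \<open>base\<close> become equal, to zero.  So \<open>S\<close> is a semi-component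
  module, and the zero columns are exactly those in which the component extension restores a 1 in
  the added row (\<open>extension_basis_map\<close>).

  Uniqueness is a cancellation law.  Let \<open>S \<oplus> I\<close> and \<open>S' \<oplus> I'\<close> be isomorphic, with \<open>I\<close> and \<open>I'\<close>
  intervals with support \<open>{q. p \<le> q}\<close>.  Since the support has a least element, a homomorphism from
  \<open>I\<close> to \<open>I'\<close> is multiplication by a single scalar, hence zero or bijective
  (\<open>interval_hom_zero_or_bij\<close>).  If the component \<open>I \<rightarrow> I'\<close> of the isomorphism is zero, a shear of
  \<open>S' \<oplus> I'\<close> makes it bijective, and then \<open>S'\<close> and \<open>S\<close> are complements of the same submodule
  (\<open>cancel_summand\<close>).  If instead of the support of \<open>I'\<close> it is known that the module is a component
  extension of \<open>S'\<close>, counting dimensions shows that the support of \<open>I'\<close> is again \<open>{q. p \<le> q}\<close>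
  (\<open>interval_support_if_component_extension\<close>).
\<close>

section \<open>Linear maps between subspaces\<close>

lemma lin_mapD:
  assumes "lin_map s V t W f"
  shows "x \<in> V \<Longrightarrow> f x \<in> W"
    and "x \<in> V \<Longrightarrow> y \<in> V \<Longrightarrow> f (x + y) = f x + f y"
    and "x \<in> V \<Longrightarrow> f (s a x) = t a (f x)"
  using assms by (simp_all add: lin_map_def)

lemma lin_map_zero:
  assumes "lin_map s V t W f" "0 \<in> V"
  shows "f 0 = 0"
proof -
  have "f (0 + 0) = f 0 + f 0"
    using assms by (simp only: lin_map_def)
  then show ?thesis by simp
qed

lemma lin_map_diff:
  assumes f: "lin_map s V t W f" and s: "vector_space s" "module.subspace s V"
    and xy: "x \<in> V" "y \<in> V"
  shows "f (x - y) = f x - f y"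
proof -
  interpret vector_space s by fact
  have "x - y \<in> V" using s xy by (simp add: subspace_diff)
  then have "f (x - y + y) = f (x - y) + f y"
    using lin_mapD(2)[OF f] xy by blast
  then show ?thesis by (simp add: algebra_simps)
qed

lemma lin_map_compose:
  assumes "lin_map s V t W f" "lin_map t W u X h"
  shows "lin_map s V u X (\<lambda>x. h (f x))"
  using assms by (simp add: lin_map_def)

lemma lin_map_eq_on_span:
  assumes s: "vector_space s" and sp: "module.span s B = V"
    and f: "lin_map s V t W f" and h: "lin_map s V t X h"
    and eq: "\<And>b. b \<in> B \<Longrightarrow> f b = h b" and x: "x \<in> V"
  shows "f x = h x"
proof -
  interpret vector_space s by fact
  have "x \<in> span B" using x sp by simp
  then have "x \<in> V \<and> f x = h x"
  proof (induction rule: span_induct_alt)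
    case base
    have "0 \<in> V" using sp span_zero by blast
    then show ?case using lin_map_zero[OF f] lin_map_zero[OF h] by simp
  next
    case (step a b y)
    have b: "b \<in> V" "s a b \<in> V"
      using step(1) sp span_base span_scale by blast+
    have "s a b + y \<in> V" using b step sp span_add by blast
    then show ?case using b step eq lin_mapD[OF f] lin_mapD[OF h] by metis
  qed
  then show ?thesis by simp
qed

lemma lin_map_inv:
  assumes f: "lin_map s V t W f" and bij: "bij_betw f V W"
    and s: "vector_space s" "module.subspace s V"
  shows "lin_map t W s V (inv_into V f)"
proof -
  interpret vector_space s by fact
  let ?h = "inv_into V f"
  have inv: "?h y \<in> V" "f (?h y) = y" if "y \<in> W" for y
    using that bij bij_betw_inv_into_right[OF bij] inv_into_into[of y f V]
    by (auto simp: bij_betw_def)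
  have left: "?h (f x) = x" if "x \<in> V" for x
    using that bij by (simp add: bij_betw_inv_into_left)
  have "?h (x + y) = ?h x + ?h y" if "x \<in> W" "y \<in> W" for x y
  proof -
    have "?h x + ?h y \<in> V" using inv that s by (simp add: subspace_add)
    moreover have "f (?h x + ?h y) = x + y" using inv that lin_mapD(2)[OF f] by simp
    ultimately show ?thesis using left by metis
  qed
  moreover have "?h (t a x) = s a (?h x)" if "x \<in> W" for a x
  proof -
    have "s a (?h x) \<in> V" using inv that s by (simp add: subspace_scale)
    moreover have "f (s a (?h x)) = t a x" using inv that lin_mapD(3)[OF f] by simp
    ultimately show ?thesis using left by metis
  qed
  ultimately show ?thesis using inv by (simp add: lin_map_def)
qed

text \<open>
  A basis \<open>B\<close> of \<open>V\<close> is a spanning set of least size.  The image of \<open>B\<close> spans \<open>V\<close>, so \<open>f\<close>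
  cannot identify two vectors of \<open>B\<close>, and no vector of the image is in the span of the others.
  A linear map that sends a basis bijectively to an independent set is injective.  Since \<open>f\<close> is
  linear only on \<open>V\<close>, it is first replaced by a map \<open>F\<close> that is linear everywhere.
\<close>

lemma surjective_endomorphism_injective:
  assumes s: "vector_space s" and fin: "finite A" "module.span s A = V"
    and f: "lin_map s V s V f" and surj: "f ` V = V"
    and x: "x \<in> V" "f x = 0"
  shows "x = 0"
proof -
  interpret vector_space s by fact
  interpret pair: vector_space_pair s s ..
  obtain B where B: "B \<subseteq> A" "independent B" "A \<subseteq> span B"
    using maximal_independent_subset[of A] by blast
  have sp: "span B = V" using B fin by (metis span_mono span_span subset_antisym)
  have finB: "finite B" using B fin finite_subset by blast
  define F where "F = pair.construct B f"
  have F: "Vector_Spaces.linear s s F"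
    unfolding F_def by (rule pair.linear_construct[OF B(2)])
  interpret F: Vector_Spaces.linear s s F by (rule F)
  have FB: "F b = f b" if "b \<in> B" for b
    unfolding F_def using pair.construct_basis[OF B(2) that] .
  have FV: "lin_map s V s UNIV F" by (simp add: lin_map_def F.add F.scale)
  have Ff: "F y = f y" if "y \<in> V" for y
    using lin_map_eq_on_span[OF s sp FV f FB that] .
  have img: "span (F ` B) = V"
    using F.span_image[of B] sp surj Ff by simp
  have minimal: "card B \<le> card T" if "finite T" "V \<subseteq> span T" for T
    using independent_span_bound[OF that(1) B(2)] that sp span_superset by blast
  have "card B \<le> card (F ` B)" using minimal img finB by blast
  then have inj: "inj_on F B"
    using finB card_image_le eq_card_imp_inj_on le_antisym by metis
  have ind: "independent (F ` B)"
  proof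
    assume "dependent (F ` B)"
    then obtain c where c: "c \<in> F ` B" "c \<in> span (F ` B - {c})"
      unfolding dependent_def by blast
    have "span (F ` B - {c}) = V"
      using c img by (metis insert_Diff span_redundant)
    then have "card B \<le> card (F ` B - {c})" using minimal[of "F ` B - {c}"] finB by simp
    also have "\<dots> < card (F ` B)"
      using c finB by (meson card_Diff1_less finite_imageI)
    also have "\<dots> \<le> card B" using finB card_image_le by blast
    finally show False by simp
  qed
  have "inj_on F (span B)"
    using pair.linear_inj_on_span_iff_independent_image[OF F ind] inj by simp
  then show ?thesis
    using x sp Ff F.zero span_zero[of B] by (metis inj_onD)
qed

section \<open>Homomorphisms of persistence modules\<close>

definition pmod_hom ::
  "('p::order, 'k::field, 'v::ab_group_add) pmod \<Rightarrow> ('p, 'k, 'w::ab_group_add) pmod \<Rightarrow>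
   ('p \<Rightarrow> 'v \<Rightarrow> 'w) \<Rightarrow> bool" where
  "pmod_hom M N f \<longleftrightarrow>
     (\<forall>q. lin_map (scl M) (spc M q) (scl N) (spc N q) (f q)) \<and>
     (\<forall>q r. q \<le> r \<longrightarrow> (\<forall>x\<in>spc M q. f r (tr M q r x) = tr N q r (f q x)))"

lemma pmod_homD:
  assumes "pmod_hom M N f"
  shows "lin_map (scl M) (spc M q) (scl N) (spc N q) (f q)"
    and "q \<le> r \<Longrightarrow> x \<in> spc M q \<Longrightarrow> f r (tr M q r x) = tr N q r (f q x)"
  using assms by (simp_all add: pmod_hom_def)

lemma pmod_hom_maps: "pmod_hom M N f \<Longrightarrow> x \<in> spc M q \<Longrightarrow> f q x \<in> spc N q"
  by (simp add: pmod_hom_def lin_map_def)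

lemma pmod_hom_compose:
  assumes f: "pmod_hom M N f" and h: "pmod_hom N L h"
  shows "pmod_hom M L (\<lambda>q x. h q (f q x))"
  using lin_map_compose[OF pmod_homD(1)[OF f] pmod_homD(1)[OF h]]
    pmod_homD(2)[OF f] pmod_homD(2)[OF h] pmod_hom_maps[OF f]
  unfolding pmod_hom_def by metis

lemma persistence_moduleD:
  assumes "persistence_module M"
  shows "vector_space (scl M)"
    and "module.subspace (scl M) (spc M q)"
    and "\<exists>A. finite A \<and> module.span (scl M) A = spc M q"
    and "q \<le> r \<Longrightarrow> lin_map (scl M) (spc M q) (scl M) (spc M r) (tr M q r)"
    and "x \<in> spc M q \<Longrightarrow> tr M q q x = x"
    and "q \<le> r \<Longrightarrow> r \<le> t \<Longrightarrow> x \<in> spc M q \<Longrightarrow> tr M r t (tr M q r x) = tr M q t x"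
  using assms by (simp_all add: persistence_module_def)

lemma persistence_module_closed:
  assumes M: "persistence_module M"
  shows "0 \<in> spc M q"
    and "x \<in> spc M q \<Longrightarrow> y \<in> spc M q \<Longrightarrow> x + y \<in> spc M q"
    and "x \<in> spc M q \<Longrightarrow> y \<in> spc M q \<Longrightarrow> x - y \<in> spc M q"
    and "x \<in> spc M q \<Longrightarrow> scl M a x \<in> spc M q"
    and "q \<le> r \<Longrightarrow> x \<in> spc M q \<Longrightarrow> tr M q r x \<in> spc M r"
    and "q \<le> r \<Longrightarrow> tr M q r 0 = 0"
    and "scl M a 0 = 0"
proof -
  interpret vector_space "scl M" using M by (rule persistence_moduleD)
  note sub = persistence_moduleD(2)[OF M]
  show "0 \<in> spc M q" using sub by (rule subspace_0)
  then show "q \<le> r \<Longrightarrow> tr M q r 0 = 0"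
    using lin_map_zero persistence_moduleD(4)[OF M] by blast
  show "x \<in> spc M q \<Longrightarrow> y \<in> spc M q \<Longrightarrow> x + y \<in> spc M q"
    using sub by (simp add: subspace_add)
  show "x \<in> spc M q \<Longrightarrow> y \<in> spc M q \<Longrightarrow> x - y \<in> spc M q"
    using sub by (simp add: subspace_diff)
  show "x \<in> spc M q \<Longrightarrow> scl M a x \<in> spc M q"
    using sub by (simp add: subspace_scale)
  show "q \<le> r \<Longrightarrow> x \<in> spc M q \<Longrightarrow> tr M q r x \<in> spc M r"
    using persistence_moduleD(4)[OF M] lin_mapD(1) by blast
  show "scl M a 0 = 0" by simp
qed

lemma pmod_hom_zero:
  "persistence_module M \<Longrightarrow> pmod_hom M N f \<Longrightarrow> f q 0 = 0"
  using lin_map_zero pmod_homD(1) persistence_module_closed(1) by metis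

text \<open>
  Isomorphism with the inverse made explicit, so that composites and components of the inverse can
  be used as homomorphisms.
\<close>

definition pmod_inverse ::
  "('p::order, 'k::field, 'v::ab_group_add) pmod \<Rightarrow> ('p, 'k, 'w::ab_group_add) pmod \<Rightarrow>
   ('p \<Rightarrow> 'v \<Rightarrow> 'w) \<Rightarrow> ('p \<Rightarrow> 'w \<Rightarrow> 'v) \<Rightarrow> bool" where
  "pmod_inverse M N f h \<longleftrightarrow> pmod_hom M N f \<and> pmod_hom N M h \<and>
     (\<forall>q. \<forall>x\<in>spc M q. h q (f q x) = x) \<and> (\<forall>q. \<forall>y\<in>spc N q. f q (h q y) = y)"

lemma pmod_inverseD:
  assumes "pmod_inverse M N f h"
  shows "pmod_hom M N f" and "pmod_hom N M h"
    and "x \<in> spc M q \<Longrightarrow> h q (f q x) = x" and "y \<in> spc N q \<Longrightarrow> f q (h q y) = y"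
  using assms by (simp_all add: pmod_inverse_def)

lemma pmod_inverse_sym: "pmod_inverse M N f h \<Longrightarrow> pmod_inverse N M h f"
  by (simp add: pmod_inverse_def)

lemma pmod_inverse_trans:
  assumes "pmod_inverse M N f h" "pmod_inverse N L f' h'"
  shows "pmod_inverse M L (\<lambda>q x. f' q (f q x)) (\<lambda>q x. h q (h' q x))"
  using assms pmod_hom_compose[of M N f L f'] pmod_hom_compose[of L N h' M h]
    pmod_hom_maps[of M N f] pmod_hom_maps[of L N h']
  unfolding pmod_inverse_def by simp

lemma pmod_inverse_bij: "pmod_inverse M N f h \<Longrightarrow> bij_betw (f q) (spc M q) (spc N q)"
  by (rule bij_betw_byWitness[where f' = "h q"])
    (auto simp: pmod_inverse_def dest: pmod_hom_maps)

lemma pmod_isoI: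
  assumes "pmod_inverse M N f h"
  shows "pmod_iso M N"
  using pmod_inverse_bij[OF assms] pmod_inverseD(1)[OF assms]
  unfolding pmod_iso_def pmod_hom_def by blast

lemma pmod_inverse_inv_into:
  assumes M: "persistence_module M" and f: "pmod_hom M N f"
    and bij: "\<And>q. bij_betw (f q) (spc M q) (spc N q)"
  shows "pmod_inverse M N f (\<lambda>q. inv_into (spc M q) (f q))"
proof -
  let ?h = "\<lambda>q. inv_into (spc M q) (f q)"
  have left: "?h q (f q x) = x" if "x \<in> spc M q" for q x
    using bij_betw_inv_into_left[OF bij that] .
  have right: "?h q y \<in> spc M q" "f q (?h q y) = y" if "y \<in> spc N q" for q y
    using that bij bij_betw_inv_into_right[OF bij] inv_into_into[of y "f q" "spc M q"]
    by (auto simp: bij_betw_def)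
  have "?h r (tr N q r y) = tr M q r (?h q y)" if "q \<le> r" "y \<in> spc N q" for q r y
  proof -
    have "f r (tr M q r (?h q y)) = tr N q r y"
      using pmod_homD(2)[OF f that(1)] right that(2) by simp
    moreover have "tr M q r (?h q y) \<in> spc M r"
      using persistence_module_closed(5)[OF M that(1)] right that(2) by simp
    ultimately show ?thesis using left by metis
  qed
  moreover have "lin_map (scl N) (spc N q) (scl M) (spc M q) (?h q)" for q
    using lin_map_inv[OF pmod_homD(1)[OF f] bij persistence_moduleD(1,2)[OF M]] .
  ultimately show ?thesis
    using f left right by (simp add: pmod_inverse_def pmod_hom_def)
qed

lemma pmod_iso_obtains_inverse:
  assumes M: "persistence_module M" and iso: "pmod_iso M N"
  obtains f h where "pmod_inverse M N f h"
proof -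
  obtain f where "pmod_hom M N f" "\<And>q. bij_betw (f q) (spc M q) (spc N q)"
    using iso unfolding pmod_iso_def pmod_hom_def by blast
  then show ?thesis using pmod_inverse_inv_into[OF M] that by blast
qed

lemma pmod_iso_zero_space:
  assumes M: "persistence_module M" and iso: "pmod_iso M N"
  shows "spc M q = {0} \<longleftrightarrow> spc N q = {0}"
proof -
  obtain f h where fh: "pmod_inverse M N f h" using pmod_iso_obtains_inverse[OF M iso] .
  have z: "f q 0 = 0" "0 \<in> spc M q"
    using pmod_hom_zero[OF M pmod_inverseD(1)[OF fh]] persistence_module_closed(1)[OF M] by simp_all
  have img: "spc N q = f q ` spc M q" and inj: "inj_on (f q) (spc M q)"
    using pmod_inverse_bij[OF fh] by (simp_all add: bij_betw_def)
  show ?thesis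
  proof
    assume "spc M q = {0}"
    then show "spc N q = {0}" using img z(1) by simp
  next
    assume "spc N q = {0}"
    then have eq: "f q x = f q 0" if "x \<in> spc M q" for x
      using that img z(1) by auto
    have "x = 0" if "x \<in> spc M q" for x
      using inj_onD[OF inj eq that z(2)] that by blast
    then show "spc M q = {0}" using z(2) by auto
  qed
qed

lemma pmod_sum_simps [simp]:
  "scl (pmod_sum M N) a (x, y) = (scl M a x, scl N a y)"
  "spc (pmod_sum M N) q = spc M q \<times> spc N q"
  "tr (pmod_sum M N) q r (x, y) = (tr M q r x, tr N q r y)"
  by (simp_all add: pmod_sum_def)

lemma pmod_hom_fst: "pmod_hom (pmod_sum M N) M (\<lambda>q. fst)"
  by (auto simp: pmod_hom_def lin_map_def)

lemma pmod_hom_snd: "pmod_hom (pmod_sum M N) N (\<lambda>q. snd)"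
  by (auto simp: pmod_hom_def lin_map_def)

lemma pmod_hom_inl: "persistence_module N \<Longrightarrow> pmod_hom M (pmod_sum M N) (\<lambda>q x. (x, 0))"
  by (auto simp: pmod_hom_def lin_map_def persistence_module_closed)

lemma pmod_hom_inr: "persistence_module M \<Longrightarrow> pmod_hom N (pmod_sum M N) (\<lambda>q y. (0, y))"
  by (auto simp: pmod_hom_def lin_map_def persistence_module_closed)

section \<open>Cancelling a summand\<close>

text \<open>
  Bijectivity of the component \<open>I \<rightarrow> I'\<close> of \<open>f\<close> says that the copy of \<open>S'\<close> in \<open>S \<oplus> I\<close> obtained from
  the inverse \<open>h\<close> is a complement of \<open>I\<close>, just as \<open>S\<close> is.  Hence \<open>S'\<close>, embedded by \<open>h\<close>, projects
  isomorphically to \<open>S\<close>.  If \<open>s\<close> in \<open>S'\<close> projects to 0, then \<open>(s, 0)\<close> is the image of some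
  \<open>(0, i)\<close>, and injectivity of the component gives \<open>i = 0\<close>.  If \<open>s\<close> in \<open>S\<close> is given, surjectivity
  of the component allows one to choose \<open>i\<close> such that \<open>f\<close> maps \<open>(s, i)\<close> into \<open>S'\<close>.
\<close>

lemma cancel_summand_if_component_bij:
  assumes iso: "pmod_inverse (pmod_sum S I) (pmod_sum S' I') f h"
    and pm: "persistence_module S" "persistence_module I" "persistence_module S'"
      "persistence_module I'"
    and bij: "\<And>q. bij_betw (\<lambda>i. snd (f q (0, i))) (spc I q) (spc I' q)"
  shows "pmod_iso S' S"
proof -
  note f = pmod_inverseD(1)[OF iso] and h = pmod_inverseD(2)[OF iso]
  note hf = pmod_inverseD(3)[OF iso] and fh = pmod_inverseD(4)[OF iso]
  let ?t = "\<lambda>q s. fst (h q (s, 0))"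
  have t: "pmod_hom S' S ?t"
    using pmod_hom_compose[OF pmod_hom_compose[OF pmod_hom_inl[OF pm(4)] h] pmod_hom_fst] .
  have d: "pmod_hom I I' (\<lambda>q i. snd (f q (0, i)))"
    using pmod_hom_compose[OF pmod_hom_compose[OF pmod_hom_inr[OF pm(1)] f] pmod_hom_snd] .
  have "bij_betw (?t q) (spc S' q) (spc S q)" for q
  proof (rule bij_betw_imageI)
    have kernel: "s = 0" if s: "s \<in> spc S' q" "?t q s = 0" for s
    proof -
      obtain i where i: "h q (s, 0) = (0, i)" using s(2) by (metis prod.collapse)
      have mem: "(s, 0) \<in> spc (pmod_sum S' I') q"
        using s(1) persistence_module_closed(1)[OF pm(4)] by simp
      have iI: "i \<in> spc I q" using pmod_hom_maps[OF h mem] i by simp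
      have fi: "f q (0, i) = (s, 0)" using fh[OF mem] i by simp
      then have "snd (f q (0, i)) = snd (f q (0, 0))"
        using pmod_hom_zero[OF pm(2) d] by simp
      then have "i = 0"
        using iI bij[of q] persistence_module_closed(1)[OF pm(2)]
        by (auto simp: bij_betw_def dest: inj_onD)
      then have "(s, 0) = f q (0, 0)" using fi by simp
      moreover have "f q (0, 0) = (0, 0)"
      proof -
        have "f q 0 = 0"
          using lin_map_zero[OF pmod_homD(1)[OF f]] persistence_module_closed(1)[OF pm(1)]
            persistence_module_closed(1)[OF pm(2)] by (simp add: zero_prod_def)
        then show ?thesis by (simp add: zero_prod_def)
      qed
      ultimately show "s = 0" by simp
    qed
    show "inj_on (?t q) (spc S' q)"
    proof (rule inj_onI)
      fix x y assume xy: "x \<in> spc S' q" "y \<in> spc S' q" "?t q x = ?t q y"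
      have "?t q (x - y) = 0"
        using lin_map_diff[OF pmod_homD(1)[OF t] persistence_moduleD(1,2)[OF pm(3)] xy(1,2)] xy(3)
        by simp
      then show "x = y" using kernel[of "x - y"] persistence_module_closed(3)[OF pm(3) xy(1,2)] by simp
    qed
    show "?t q ` spc S' q = spc S q"
    proof
      show "?t q ` spc S' q \<subseteq> spc S q" using pmod_hom_maps[OF t] by blast
      show "spc S q \<subseteq> ?t q ` spc S' q"
      proof
        fix s assume s: "s \<in> spc S q"
        have s0: "(s, 0) \<in> spc (pmod_sum S I) q"
          using s persistence_module_closed(1)[OF pm(2)] by simp
        have "snd (f q (s, 0)) \<in> spc I' q" using pmod_hom_maps[OF f s0] by (auto simp: mem_Times_iff)
        then have "- snd (f q (s, 0)) \<in> spc I' q"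
          using persistence_module_closed(3)[OF pm(4) persistence_module_closed(1)[OF pm(4)]]
          by fastforce
        then have "- snd (f q (s, 0)) \<in> (\<lambda>i. snd (f q (0, i))) ` spc I q"
          using bij[of q] by (simp add: bij_betw_def)
        then obtain i where i: "- snd (f q (s, 0)) = snd (f q (0, i))" "i \<in> spc I q"
          by (rule imageE)
        have si: "(0, i) \<in> spc (pmod_sum S I) q" "(s, i) \<in> spc (pmod_sum S I) q"
          using s i persistence_module_closed(1)[OF pm(1)] by simp_all
        have "f q ((s, 0) + (0, i)) = f q (s, 0) + f q (0, i)"
          using lin_mapD(2)[OF pmod_homD(1)[OF f] s0 si(1)] .
        then have "snd (f q (s, i)) = 0" using i(1)[symmetric] by simp
        then have "f q (s, i) = (fst (f q (s, i)), 0)" by (metis prod.collapse)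
        then have "?t q (fst (f q (s, i))) = s" using hf[OF si(2)] by simp
        moreover have "fst (f q (s, i)) \<in> spc S' q"
          using pmod_hom_maps[OF f si(2)] by (auto simp: mem_Times_iff)
        ultimately show "s \<in> ?t q ` spc S' q" by force
      qed
    qed
  qed
  then show ?thesis using pmod_isoI[OF pmod_inverse_inv_into[OF pm(3) t]] by simp
qed

lemma pmod_inverse_shear:
  assumes pm: "persistence_module S" "persistence_module I" and t: "pmod_hom S I t"
  shows "pmod_inverse (pmod_sum S I) (pmod_sum S I)
           (\<lambda>q (s, i). (s, i + t q s)) (\<lambda>q (s, i). (s, i - t q s))"
proof -
  interpret I: vector_space "scl I" using pm(2) by (rule persistence_moduleD)
  note cl = persistence_module_closed[OF pm(1)] persistence_module_closed[OF pm(2)]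
  note lt = lin_mapD[OF pmod_homD(1)[OF t]]
  have "tr I q r (i + j) = tr I q r i + tr I q r j" "tr I q r (i - j) = tr I q r i - tr I q r j"
    if "q \<le> r" "i \<in> spc I q" "j \<in> spc I q" for q r i j
    using lin_mapD(2)[OF persistence_moduleD(4)[OF pm(2) that(1)] that(2,3)]
      lin_map_diff[OF persistence_moduleD(4)[OF pm(2) that(1)] persistence_moduleD(1,2)[OF pm(2)] that(2,3)]
    by simp_all
  note tr = this
  have "pmod_hom (pmod_sum S I) (pmod_sum S I) (\<lambda>q (s, i). (s, i + t q s))"
    unfolding pmod_hom_def lin_map_def
    by (auto simp: cl lt pmod_homD(2)[OF t] tr I.scale_right_distrib algebra_simps)
  moreover have "pmod_hom (pmod_sum S I) (pmod_sum S I) (\<lambda>q (s, i). (s, i - t q s))"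
    unfolding pmod_hom_def lin_map_def
    by (auto simp: cl lt pmod_homD(2)[OF t] tr I.scale_right_diff_distrib algebra_simps)
  ultimately show ?thesis by (auto simp: pmod_inverse_def)
qed

text \<open>
  A cancellation law of Krull-Schmidt type.  The hypothesis \<open>schur\<close> leaves two cases for the
  component \<open>I \<rightarrow> I'\<close> of an isomorphism \<open>f\<close> from \<open>S \<oplus> I\<close> to \<open>S' \<oplus> I'\<close>.  If it is bijective, the
  preceding argument applies directly.  If it is zero, \<open>f\<close> embeds \<open>I\<close> into \<open>S'\<close>, and the inverse of \<open>f\<close>
  recovers \<open>I\<close> from there.  Adding to the coordinate in \<open>I'\<close> the part of \<open>S'\<close> recovered in this way
  (a shear of \<open>S' \<oplus> I'\<close>) replaces the zero component by the isomorphism \<open>e\<close>.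
\<close>

lemma cancel_summand:
  assumes C: "persistence_module C" and iso: "pmod_iso C (pmod_sum S I)" "pmod_iso C (pmod_sum S' I')"
    and pm: "persistence_module S" "persistence_module I" "persistence_module S'"
      "persistence_module I'"
    and e: "pmod_hom I I' e" "\<And>q. bij_betw (e q) (spc I q) (spc I' q)"
    and schur: "\<And>d. pmod_hom I I' d \<Longrightarrow>
      (\<forall>q. \<forall>i\<in>spc I q. d q i = 0) \<or> (\<forall>q. bij_betw (d q) (spc I q) (spc I' q))"
  shows "pmod_iso S' S"
proof -
  obtain f0 h0 where fh0: "pmod_inverse C (pmod_sum S I) f0 h0"
    using pmod_iso_obtains_inverse[OF C iso(1)] .
  obtain f1 h1 where fh1: "pmod_inverse C (pmod_sum S' I') f1 h1"
    using pmod_iso_obtains_inverse[OF C iso(2)] .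
  obtain f h where fh: "pmod_inverse (pmod_sum S I) (pmod_sum S' I') f h"
    using pmod_inverse_trans[OF pmod_inverse_sym[OF fh0] fh1] by blast
  note f = pmod_inverseD(1)[OF fh] and h = pmod_inverseD(2)[OF fh]
  have d: "pmod_hom I I' (\<lambda>q i. snd (f q (0, i)))"
    using pmod_hom_compose[OF pmod_hom_compose[OF pmod_hom_inr[OF pm(1)] f] pmod_hom_snd] .
  consider (zero) "\<And>q i. i \<in> spc I q \<Longrightarrow> snd (f q (0, i)) = 0"
    | (bij) "\<And>q. bij_betw (\<lambda>i. snd (f q (0, i))) (spc I q) (spc I' q)"
    using schur[OF d] by blast
  then show ?thesis
  proof cases
    case bij
    then show ?thesis using cancel_summand_if_component_bij[OF fh pm] by blast
  next
    case zero
    let ?t = "\<lambda>q s. e q (snd (h q (s, 0)))"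
    have t: "pmod_hom S' I' ?t"
      using pmod_hom_compose[OF pmod_hom_compose[OF pmod_hom_compose[OF
            pmod_hom_inl[OF pm(4)] h] pmod_hom_snd] e(1)] .
    note sheared = pmod_inverse_trans[OF fh pmod_inverse_shear[OF pm(3,4) t]]
    show ?thesis
    proof (rule cancel_summand_if_component_bij[OF sheared pm])
      fix q
      have "snd (case f q (0, i) of (s, i') \<Rightarrow> (s, i' + ?t q s)) = e q i" if i: "i \<in> spc I q" for i
      proof -
        obtain s where s: "f q (0, i) = (s, 0)" using zero[OF i] by (metis prod.collapse)
        have "h q (f q (0, i)) = (0, i)"
          using pmod_inverseD(3)[OF fh] i persistence_module_closed(1)[OF pm(1)] by simp
        then show ?thesis using s by simp
      qed
      then show "bij_betw (\<lambda>i. snd (case f q (0, i) of (s, i') \<Rightarrow> (s, i' + ?t q s)))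
                  (spc I q) (spc I' q)"
        using e(2)[of q] by (simp cong: bij_betw_cong)
    qed
  qed
qed

section \<open>Interval modules supported on a principal up-set\<close>

text \<open>
  An interval module with support \<open>{q. p \<le> q}\<close> is determined by the compatible basis vectors
  \<open>e q\<close>.
\<close>

definition interval_basis ::
  "('p::order, 'k::field, 'v::ab_group_add) pmod \<Rightarrow> 'p \<Rightarrow> ('p \<Rightarrow> 'v) \<Rightarrow> bool" where
  "interval_basis I p e \<longleftrightarrow>
     persistence_module I \<and>
     (\<forall>q. p \<le> q \<longrightarrow> e q \<noteq> 0 \<and> module.span (scl I) {e q} = spc I q) \<and>
     (\<forall>q. \<not> p \<le> q \<longrightarrow> spc I q = {0}) \<and>
     (\<forall>q r. p \<le> q \<and> q \<le> r \<longrightarrow> tr I q r (e q) = e r)"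

lemma interval_basisD:
  assumes "interval_basis I p e"
  shows "persistence_module I"
    and "p \<le> q \<Longrightarrow> e q \<noteq> 0"
    and "p \<le> q \<Longrightarrow> spc I q = range (\<lambda>k. scl I k (e q))"
    and "\<not> p \<le> q \<Longrightarrow> spc I q = {0}"
    and "p \<le> q \<Longrightarrow> q \<le> r \<Longrightarrow> tr I q r (e q) = e r"
    and "p \<le> q \<Longrightarrow> e q \<in> spc I q"
proof -
  show pm: "persistence_module I" using assms by (simp add: interval_basis_def)
  interpret vector_space "scl I" using pm by (rule persistence_moduleD)
  show "p \<le> q \<Longrightarrow> spc I q = range (\<lambda>k. scl I k (e q))"
    using assms span_singleton[of "e q"] by (simp add: interval_basis_def)
  show "p \<le> q \<Longrightarrow> e q \<in> spc I q"
    using assms span_base[of "e q" "{e q}"] by (simp add: interval_basis_def)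
qed (use assms in \<open>simp_all add: interval_basis_def\<close>)

lemma not_iso_field_at_zero:
  fixes M :: "('p, 'k::field, 'v::ab_group_add) pmod"
  assumes "spc M q = {0}"
  shows "\<not> iso_field_at M q"
proof
  assume "iso_field_at M q"
  then obtain f :: "'k \<Rightarrow> 'v" where "bij_betw f UNIV {0}"
    using assms by (auto simp: iso_field_at_def)
  then have "f 0 = 0" "f 1 = 0" "inj f" by (auto simp: bij_betw_def)
  then show False by (metis injD zero_neq_one)
qed

lemma interval_moduleD:
  assumes "interval_module I"
  shows "persistence_module I" and "iso_field_at I q \<or> spc I q = {0}"
proof -
  show "persistence_module I" using assms unfolding interval_module_def by (elim conjE)
  have "\<forall>q. iso_field_at I q \<or> spc I q = {0}"
    using assms unfolding interval_module_def by (elim conjE)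
  then show "iso_field_at I q \<or> spc I q = {0}" by blast
qed

lemma interval_module_obtains_basis:
  assumes "interval_module I" and supp: "\<And>q. iso_field_at I q \<longleftrightarrow> p \<le> q"
  obtains e where "interval_basis I p e"
proof -
  have "\<exists>e. (\<forall>q. p \<le> q \<longrightarrow> e q \<noteq> 0 \<and> module.span (scl I) {e q} = spc I q) \<and>
            (\<forall>q r. q \<le> r \<and> p \<le> q \<and> p \<le> r \<longrightarrow> tr I q r (e q) = e r)"
    using assms(1) unfolding interval_module_def supp by (elim conjE)
  then obtain e where e1: "\<forall>q. p \<le> q \<longrightarrow> e q \<noteq> 0 \<and> module.span (scl I) {e q} = spc I q"
    and e2: "\<forall>q r. q \<le> r \<and> p \<le> q \<and> p \<le> r \<longrightarrow> tr I q r (e q) = e r"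
    by (elim exE conjE)
  have "interval_basis I p e"
    unfolding interval_basis_def
  proof (intro conjI allI impI; (elim conjE)?)
    show "persistence_module I" using interval_moduleD(1)[OF assms(1)] .
    show "spc I q = {0}" if "\<not> p \<le> q" for q
      using interval_moduleD(2)[OF assms(1)] supp that by blast
    show "tr I q r (e q) = e r" if "p \<le> q" "q \<le> r" for q r
      using e2 that order_trans[OF that] by simp
  qed (use e1 in simp_all)
  then show ?thesis by (rule that)
qed

lemma iso_field_at_interval_basis:
  assumes e: "interval_basis I p e"
  shows "iso_field_at I q \<longleftrightarrow> p \<le> q"
proof (cases "p \<le> q")
  case False
  then show ?thesis
    using not_iso_field_at_zero[OF interval_basisD(4)[OF e False]] by simp
next
  case True
  interpret vector_space "scl I" using interval_basisD(1)[OF e] by (rule persistence_moduleD)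
  have "lin_map (*) UNIV (scl I) (spc I q) (\<lambda>k. scl I k (e q))"
    using interval_basisD(3)[OF e True] by (auto simp: lin_map_def scale_left_distrib)
  moreover have "bij_betw (\<lambda>k. scl I k (e q)) UNIV (spc I q)"
    using interval_basisD(2,3)[OF e True] by (simp add: bij_betw_def inj_on_def)
  ultimately have "iso_field_at I q" unfolding iso_field_at_def by blast
  then show ?thesis using True by simp
qed

lemma interval_module_interval_basis:
  assumes e: "interval_basis I p e"
  shows "interval_module I"
  unfolding interval_module_def iso_field_at_interval_basis[OF e]
proof (intro conjI)
  show "persistence_module I" using interval_basisD(1)[OF e] .
  show "\<forall>q. p \<le> q \<or> spc I q = {0}" using interval_basisD(4)[OF e] by blast
  show "\<forall>q r t. q \<le> r \<and> r \<le> t \<and> p \<le> q \<and> p \<le> t \<longrightarrow> p \<le> r"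
    using order_trans by blast
  show "\<exists>e. (\<forall>q. p \<le> q \<longrightarrow> e q \<noteq> 0 \<and> module.span (scl I) {e q} = spc I q) \<and>
            (\<forall>q r. q \<le> r \<and> p \<le> q \<and> p \<le> r \<longrightarrow> tr I q r (e q) = e r)"
    using e unfolding interval_basis_def by (intro exI[of _ e]) simp
qed

lemma bij_betw_interval_basis:
  assumes I: "interval_basis I p e" and I': "interval_basis I' p e'"
    and d: "pmod_hom I I' d"
    and eq: "\<And>q. p \<le> q \<Longrightarrow> d q (e q) = scl I' c (e' q)" and c: "c \<noteq> 0"
  shows "bij_betw (d q) (spc I q) (spc I' q)"
proof (cases "p \<le> q")
  case False
  then show ?thesis
    using interval_basisD(4)[OF I] interval_basisD(4)[OF I']
      pmod_hom_zero[OF interval_basisD(1)[OF I] d] by (simp add: bij_betw_def)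
next
  case True
  interpret vector_space "scl I" using interval_basisD(1)[OF I] by (rule persistence_moduleD)
  interpret I': vector_space "scl I'" using interval_basisD(1)[OF I'] by (rule persistence_moduleD)
  note spc = interval_basisD(3)[OF I True] interval_basisD(3)[OF I' True]
  have dk: "d q (scl I k (e q)) = scl I' (k * c) (e' q)" for k
    using lin_mapD(3)[OF pmod_homD(1)[OF d] interval_basisD(6)[OF I True]] eq[OF True] by simp
  have "range (\<lambda>k. scl I' (k * c) (e' q)) = range (\<lambda>k. scl I' k (e' q))"
  proof
    show "range (\<lambda>k. scl I' k (e' q)) \<subseteq> range (\<lambda>k. scl I' (k * c) (e' q))"
    proof
      fix y assume "y \<in> range (\<lambda>k. scl I' k (e' q))"
      then obtain k where "y = scl I' (k / c * c) (e' q)" using c by auto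
      then show "y \<in> range (\<lambda>k. scl I' (k * c) (e' q))" by blast
    qed
  qed auto
  moreover have "inj_on (d q) (range (\<lambda>k. scl I k (e q)))"
    using interval_basisD(2)[OF I' True] c by (auto simp: inj_on_def dk)
  ultimately show ?thesis unfolding spc bij_betw_def by (simp add: image_image dk)
qed

text \<open>
  Because the support has the least element \<open>p\<close>, every basis vector is transported from \<open>p\<close>.  So a
  homomorphism is multiplication by one scalar everywhere, namely the scalar \<open>c\<close> at \<open>p\<close>.
\<close>

lemma interval_hom_zero_or_bij:
  assumes I: "interval_basis I p e" and I': "interval_basis I' p e'"
    and d: "pmod_hom I I' d"
  shows "(\<forall>q. \<forall>i\<in>spc I q. d q i = 0) \<or> (\<forall>q. bij_betw (d q) (spc I q) (spc I' q))"
proof -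
  interpret I': vector_space "scl I'" using interval_basisD(1)[OF I'] by (rule persistence_moduleD)
  obtain c where c: "d p (e p) = scl I' c (e' p)"
    using pmod_hom_maps[OF d interval_basisD(6)[OF I]] interval_basisD(3)[OF I', of p] by auto
  have dc: "d q (e q) = scl I' c (e' q)" if "p \<le> q" for q
  proof -
    have "d q (e q) = tr I' p q (d p (e p))"
      using pmod_homD(2)[OF d that interval_basisD(6)[OF I]] interval_basisD(5)[OF I _ that] by simp
    also have "\<dots> = scl I' c (tr I' p q (e' p))"
      unfolding c
      using lin_mapD(3)[OF persistence_moduleD(4)[OF interval_basisD(1)[OF I'] that]]
        interval_basisD(6)[OF I'] by simp
    also have "tr I' p q (e' p) = e' q" using interval_basisD(5)[OF I' _ that] by simp
    finally show ?thesis .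
  qed
  show ?thesis
  proof (cases "c = 0")
    case False
    then show ?thesis using bij_betw_interval_basis[OF I I' d dc] by blast
  next
    case True
    have "d q i = 0" if i: "i \<in> spc I q" for q i
    proof (cases "p \<le> q")
      case pq: True
      obtain k where "i = scl I k (e q)" using i interval_basisD(3)[OF I pq] by auto
      then have "d q i = scl I' k (d q (e q))"
        using lin_mapD(3)[OF pmod_homD(1)[OF d] interval_basisD(6)[OF I pq]] by simp
      then show ?thesis using dc[OF pq] True by simp
    next
      case False
      then show ?thesis
        using i interval_basisD(4)[OF I] pmod_hom_zero[OF interval_basisD(1)[OF I] d] by simp
    qed
    then show ?thesis by blast
  qed
qed

lemma interval_basis_hom_exists:
  assumes I: "interval_basis I p e" and I': "interval_basis I' p e'"
  shows "\<exists>d. pmod_hom I I' d \<and> (\<forall>q. bij_betw (d q) (spc I q) (spc I' q))"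
proof -
  interpret vector_space "scl I" using interval_basisD(1)[OF I] by (rule persistence_moduleD)
  interpret I': vector_space "scl I'" using interval_basisD(1)[OF I'] by (rule persistence_moduleD)
  \<comment> \<open>The coefficient of 0 is 0 even where \<open>{e q}\<close> is not independent, so \<open>d\<close> needs no case
    distinction outside the support.\<close>
  define d where "d q x = scl I' (representation {e q} x (e q)) (e' q)" for q x
  have ind: "independent {e q}" if "p \<le> q" for q
    using interval_basisD(2)[OF I that] by simp
  have dk: "d q (scl I k (e q)) = scl I' k (e' q)" if "p \<le> q" for q k
    using representation_scale[OF ind[OF that] span_base, of "e q" k]
      representation_basis[OF ind[OF that], of "e q"] by (simp add: d_def)
  have d0: "d q 0 = 0" for q by (simp add: d_def representation_zero)
  have "lin_map (scl I) (spc I q) (scl I') (spc I' q) (d q)" for q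
  proof (cases "p \<le> q")
    case True
    then show ?thesis
      unfolding interval_basisD(3)[OF I True] interval_basisD(3)[OF I' True] lin_map_def
      by (auto simp: dk scale_left_distrib[symmetric] I'.scale_left_distrib[symmetric])
  next
    case False
    then show ?thesis
      using interval_basisD(4)[OF I] interval_basisD(4)[OF I'] by (simp add: lin_map_def d0)
  qed
  moreover have "d r (tr I q r x) = tr I' q r (d q x)" if qr: "q \<le> r" and x: "x \<in> spc I q" for q r x
  proof (cases "p \<le> q")
    case True
    then obtain k where k: "x = scl I k (e q)" using x interval_basisD(3)[OF I] by auto
    have pr: "p \<le> r" using True qr by simp
    have "tr I q r x = scl I k (e r)"
      using lin_mapD(3)[OF persistence_moduleD(4)[OF interval_basisD(1)[OF I] qr]
          interval_basisD(6)[OF I True]] interval_basisD(5)[OF I True qr] k by simp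
    moreover have "tr I' q r (scl I' k (e' q)) = scl I' k (e' r)"
      using lin_mapD(3)[OF persistence_moduleD(4)[OF interval_basisD(1)[OF I'] qr]
          interval_basisD(6)[OF I' True]] interval_basisD(5)[OF I' True qr] by simp
    ultimately show ?thesis using dk[OF True] dk[OF pr] k by simp
  next
    case False
    then have "x = 0" using x interval_basisD(4)[OF I] by simp
    then show ?thesis
      using d0 persistence_module_closed(6)[OF interval_basisD(1)[OF I] qr]
        persistence_module_closed(6)[OF interval_basisD(1)[OF I'] qr] by simp
  qed
  ultimately have d: "pmod_hom I I' d" by (simp add: pmod_hom_def)
  have "d q (e q) = scl I' 1 (e' q)" if "p \<le> q" for q using dk[OF that, of 1] by simp
  then show ?thesis using d bij_betw_interval_basis[OF I I' d, of 1] by fastforce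
qed

lemma cancel_interval:
  assumes C: "persistence_module C" and iso: "pmod_iso C (pmod_sum S I)" "pmod_iso C (pmod_sum S' I')"
    and pm: "persistence_module S" "persistence_module S'"
    and I: "interval_basis I p e" and I': "interval_basis I' p e'"
  shows "pmod_iso S' S" and "pmod_iso I' I"
proof -
  obtain d where d: "pmod_hom I I' d" "\<And>q. bij_betw (d q) (spc I q) (spc I' q)"
    using interval_basis_hom_exists[OF I I'] by blast
  show "pmod_iso S' S"
    by (rule cancel_summand[OF C iso pm(1) interval_basisD(1)[OF I] pm(2) interval_basisD(1)[OF I'] d
          interval_hom_zero_or_bij[OF I I']])
  obtain d' where d': "pmod_hom I' I d'" "\<And>q. bij_betw (d' q) (spc I' q) (spc I q)"
    using interval_basis_hom_exists[OF I' I] by blast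
  show "pmod_iso I' I"
    using pmod_isoI[OF pmod_inverse_inv_into[OF interval_basisD(1)[OF I'] d']] .
qed

section \<open>The summand split off by a component extension\<close>

lemma component_extension_simps:
  "scl (component_extension S B p) = (\<lambda>a (x, v). (a * x, scl S a v))"
  "p \<le> q \<Longrightarrow> spc (component_extension S B p) q = UNIV \<times> spc S q"
  "\<not> p \<le> q \<Longrightarrow> spc (component_extension S B p) q = {0}"
  "tr (component_extension S B p) q r (a, v) =
     (a + (\<Sum>b\<in>B q. new_row S B q r b * module.representation (scl S) (B q) v b), tr S q r v)"
  by (simp_all add: component_extension_def)

lemma lin_map_component_extension_tr:
  assumes B: "semi_component_basis S B" and pq: "p \<le> q" and qr: "q \<le> r"
  shows "lin_map (scl (component_extension S B p)) (spc (component_extension S B p) q)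
           (scl (component_extension S B p)) (spc (component_extension S B p) r)
           (tr (component_extension S B p) q r)"
proof -
  have S: "persistence_module S" using B by (simp add: semi_component_basis_def)
  interpret vector_space "scl S" using S by (rule persistence_moduleD)
  have ind: "independent (B q)" and sp: "spc S q = span (B q)"
    using B by (simp_all add: semi_component_basis_def basis_family_def)
  note lin = lin_mapD[OF persistence_moduleD(4)[OF S qr]]
  have pr: "p \<le> r" using pq qr by simp
  show ?thesis
    unfolding lin_map_def
    using pq pr lin representation_add[OF ind] representation_scale[OF ind]
    by (auto simp: component_extension_simps sp algebra_simps sum.distrib sum_distrib_left)
qed

text \<open>
  The spaces of a component extension at \<open>p'\<close> are nonzero exactly above \<open>p'\<close>, so \<open>p' = p\<close>.  Above \<open>p\<close>
  the extension is one dimension larger than \<open>S\<close>, so \<open>I\<close> cannot vanish there: otherwise the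
  finite-dimensional space \<open>spc S q\<close> would be isomorphic to its own sum with the field.
\<close>

lemma interval_support_if_component_extension:
  fixes S :: "('p::order, 'k::field, 's::ab_group_add) pmod"
    and I :: "('p, 'k, 'i::ab_group_add) pmod"
  assumes C: "persistence_module C" and supp: "\<And>q. spc C q = {0} \<longleftrightarrow> \<not> p \<le> q"
    and sum: "pmod_iso C (pmod_sum S I)" and I: "interval_module I"
    and ext: "is_component_extension C S B p'"
  shows "iso_field_at I q \<longleftrightarrow> p \<le> q"
proof -
  have S: "persistence_module S"
    using ext by (simp add: is_component_extension_def semi_component_basis_def)
  note pmI = interval_moduleD(1)[OF I] and I_cases = interval_moduleD(2)[OF I]
  let ?E = "component_extension S B p'"
  have iso: "pmod_iso C ?E" using ext by (simp add: is_component_extension_def)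
  have S0: "0 \<in> spc S q" for q using persistence_module_closed(1)[OF S] .
  have suppE: "spc ?E q = {0} \<longleftrightarrow> \<not> p' \<le> q" for q
  proof
    assume E: "spc ?E q = {0}"
    show "\<not> p' \<le> q"
    proof
      assume "p' \<le> q"
      then have "(1, 0) \<in> spc ?E q" using S0 by (simp add: component_extension_simps)
      then show False unfolding E by (simp add: zero_prod_def)
    qed
  qed (rule component_extension_simps(3))
  have up: "p \<le> q \<longleftrightarrow> p' \<le> q" for q
    using pmod_iso_zero_space[OF C iso, of q] supp[of q] suppE[of q] by blast
  have p': "p' = p" using up[of p] up[of p'] by auto
  obtain f0 h0 where fh0: "pmod_inverse C (pmod_sum S I) f0 h0"
    using pmod_iso_obtains_inverse[OF C sum] .
  obtain f1 h1 where fh1: "pmod_inverse C ?E f1 h1"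
    using pmod_iso_obtains_inverse[OF C iso] .
  obtain f h where fh: "pmod_inverse (pmod_sum S I) ?E f h"
    using pmod_inverse_trans[OF pmod_inverse_sym[OF fh0] fh1] by blast
  have fl: "lin_map (scl (pmod_sum S I)) (spc (pmod_sum S I) q) (scl ?E) (spc ?E q) (f q)"
    using pmod_homD(1)[OF pmod_inverseD(1)[OF fh]] .
  have I0: "0 \<in> spc I q" using persistence_module_closed(1)[OF pmI] .
  have f0: "f q (0, 0) = (0, 0)"
    using lin_map_zero[OF fl] S0 I0 by (simp add: zero_prod_def)
  show ?thesis
  proof (cases "p \<le> q")
    case False
    have "spc C q = {0}" using supp False by simp
    then have "spc S q \<times> spc I q = {0}"
      using pmod_iso_zero_space[OF C sum] by simp
    then have "spc I q = {0}" using S0 I0 by (auto simp: zero_prod_def)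
    then show ?thesis using not_iso_field_at_zero[of I q] False by simp
  next
    case True
    have "iso_field_at I q"
    proof (rule ccontr)
      assume "\<not> iso_field_at I q"
      then have Iq: "spc I q = {0}" using I_cases[of q] by simp
      have Eq: "spc ?E q = UNIV \<times> spc S q"
        using True p' by (simp add: component_extension_simps)
      \<comment> \<open>An isomorphism from \<open>spc S q\<close> to \<open>UNIV \<times> spc S q\<close>, followed by the projection, is a surjective
        endomorphism of \<open>spc S q\<close>, but it kills the nonzero preimage of \<open>(1, 0)\<close>.\<close>
      let ?u = "\<lambda>x. snd (f q (x, 0))"
      have pre: "\<exists>x\<in>spc S q. f q (x, 0) = (a, y)" if y: "y \<in> spc S q" for a y
      proof -
        have ay: "(a, y) \<in> spc ?E q" using y Eq by simp
        have "h q (a, y) \<in> spc S q \<times> {0}"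
          using pmod_hom_maps[OF pmod_inverseD(2)[OF fh] ay] Iq by simp
        then obtain x where "x \<in> spc S q" "h q (a, y) = (x, 0)" by blast
        then show ?thesis using pmod_inverseD(4)[OF fh ay] by metis
      qed
      have maps: "f q (x, 0) \<in> UNIV \<times> spc S q" if "x \<in> spc S q" for x
        using lin_mapD(1)[OF fl] that I0 Eq by simp
      have u: "lin_map (scl S) (spc S q) (scl S) (spc S q) ?u"
        unfolding lin_map_def
      proof (intro conjI ballI allI)
        show "?u x \<in> spc S q" if "x \<in> spc S q" for x
          using maps[OF that] by auto
        show "?u (x + y) = ?u x + ?u y" if "x \<in> spc S q" "y \<in> spc S q" for x y
          using lin_mapD(2)[OF fl, of "(x, 0)" "(y, 0)"] that I0 by simp
        show "?u (scl S a x) = scl S a (?u x)" if "x \<in> spc S q" for a x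
          using lin_mapD(3)[OF fl, of "(x, 0)" a] that I0 persistence_module_closed(7)[OF pmI]
          by (simp add: component_extension_simps split: prod.splits)
      qed
      have surj: "?u ` spc S q = spc S q"
      proof
        show "?u ` spc S q \<subseteq> spc S q" using lin_mapD(1)[OF u] by blast
        show "spc S q \<subseteq> ?u ` spc S q"
        proof
          fix y assume "y \<in> spc S q"
          then obtain x where "x \<in> spc S q" "f q (x, 0) = (0, y)" using pre by blast
          then show "y \<in> ?u ` spc S q" by force
        qed
      qed
      obtain A where A: "finite A" "module.span (scl S) A = spc S q"
        using persistence_moduleD(3)[OF S] by blast
      obtain x where x: "x \<in> spc S q" "f q (x, 0) = (1, 0)" using pre[OF S0] by blast
      have "x = 0"
        using surjective_endomorphism_injective[OF persistence_moduleD(1)[OF S] A u surj x(1)] x(2)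
        by simp
      then show False using x f0 by simp
    qed
    then show ?thesis using True by simp
  qed
qed

section \<open>Splitting off the line of the minimal generator\<close>

lemma persistence_submodule:
  assumes M: "persistence_module M"
    and sub: "\<And>q. module.subspace (scl M) (V q)" "\<And>q. V q \<subseteq> spc M q"
    and fin: "\<And>q. \<exists>A. finite A \<and> module.span (scl M) A = V q"
    and tr: "\<And>q r x. q \<le> r \<Longrightarrow> x \<in> V q \<Longrightarrow> tr M q r x \<in> V r"
  shows "persistence_module (M\<lparr>spc := V\<rparr>)"
proof -
  have lin: "lin_map (scl M) (V q) (scl M) (V r) (tr M q r)" if "q \<le> r" for q r
    using lin_mapD(2,3)[OF persistence_moduleD(4)[OF M that]] sub(2)[of q] tr[OF that]
    unfolding lin_map_def by blast
  have comp: "tr M r t (tr M q r x) = tr M q t x" if "q \<le> r" "r \<le> t" "x \<in> V q" for q r t x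
    using persistence_moduleD(6)[OF M that(1,2)] that(3) sub(2)[of q] by blast
  have refl: "tr M q q x = x" if "x \<in> V q" for q x
    using persistence_moduleD(5)[OF M] that sub(2)[of q] by blast
  show ?thesis
    unfolding persistence_module_def
    by (simp add: persistence_moduleD(1)[OF M] sub(1) fin lin refl comp)
qed

text \<open>
  The transition maps of a component module carry basis vectors to basis vectors.  Here \<open>g\<close> is any
  basis vector at \<open>p\<close>, and the module lives above \<open>p\<close>, so that the images of \<open>g\<close> pick one basis
  vector in every nonzero space.
\<close>

locale pointed_component_module =
  fixes C :: "('p::order, 'k::field, 'v::ab_group_add) pmod"
    and B :: "'p \<Rightarrow> 'v set" and p :: 'p and g :: 'v
  assumes comp: "component_basis C B"
    and g: "g \<in> B p"
    and above: "b \<in> B q \<Longrightarrow> p \<le> q"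
begin

lemma persistence_C: "persistence_module C"
  using comp by (simp add: component_basis_def)

sublocale vector_space "scl C"
  using persistence_C by (rule persistence_moduleD)

lemma independent_B: "independent (B q)" and span_B: "span (B q) = spc C q"
  using comp by (simp_all add: component_basis_def basis_family_def)

lemma B_spc: "b \<in> B q \<Longrightarrow> b \<in> spc C q"
  using span_B span_base by blast

lemma finite_B: "finite (B q)"
proof -
  obtain A where "finite A" "span A = spc C q" using persistence_moduleD(3)[OF persistence_C] by blast
  moreover have "B q \<subseteq> spc C q" using B_spc by blast
  ultimately show ?thesis using independent_span_bound independent_B by blast
qed

lemmas tr_B = component_basis_tr[OF comp]

lemma spc_eq_zero_iff: "spc C q = {0} \<longleftrightarrow> \<not> p \<le> q"
proof (cases "p \<le> q")
  case True
  have "tr C p q g \<in> B q" using tr_B[OF True g] .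
  moreover from this have "tr C p q g \<noteq> 0" using independent_B dependent_zero by metis
  ultimately show ?thesis using True B_spc by blast
next
  case False
  then have "B q = {}" using above by blast
  then show ?thesis using span_B[of q] False by simp
qed

lemma repr_lin: "lin_map (scl C) (spc C q) (*) UNIV (\<lambda>x. representation (B q) x b)"
  unfolding lin_map_def span_B[symmetric]
  by (simp add: representation_add[OF independent_B] representation_scale[OF independent_B])

lemma repr_B: "b \<in> B q \<Longrightarrow> representation (B q) b c = (if c = b then 1 else 0)"
  using representation_basis[OF independent_B] by simp

definition base :: "'p \<Rightarrow> 'v" where
  "base q = tr C p q g"

lemma base_B: "p \<le> q \<Longrightarrow> base q \<in> B q"
  unfolding base_def using tr_B g by blast

lemma base_spc: "p \<le> q \<Longrightarrow> base q \<in> spc C q"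
  using base_B B_spc by blast

lemma tr_base: "p \<le> q \<Longrightarrow> q \<le> r \<Longrightarrow> tr C q r (base q) = base r"
  unfolding base_def using persistence_moduleD(6)[OF persistence_C] B_spc[OF g] by blast

text \<open>
  The augmentation.  Read as the multiple \<open>aug q x\<close> of \<open>base q\<close>, it is a retraction onto the line of
  \<open>base q\<close>.
\<close>

definition aug :: "'p \<Rightarrow> 'v \<Rightarrow> 'k" where
  "aug q x = (\<Sum>b\<in>B q. representation (B q) x b)"

lemma aug_lin: "lin_map (scl C) (spc C q) (*) UNIV (aug q)"
  unfolding lin_map_def aug_def
  using lin_mapD(2,3)[OF repr_lin] by (simp add: sum.distrib sum_distrib_left)

lemmas aug_add = lin_mapD(2)[OF aug_lin] and aug_scale = lin_mapD(3)[OF aug_lin]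
  and aug_diff = lin_map_diff[OF aug_lin persistence_moduleD(1,2)[OF persistence_C]]

lemma aug_B: "b \<in> B q \<Longrightarrow> aug q b = 1"
  using finite_B by (simp add: aug_def repr_B)

text \<open>
  Both sides are linear in \<open>x\<close>, and both are 1 on basis vectors because transition maps permit no
  basis vector to vanish.  So the augmentation is a homomorphism to the interval module of \<open>base\<close>, and
  sending 1 to \<open>base q\<close> splits it.
\<close>

lemma aug_tr:
  assumes qr: "q \<le> r" and x: "x \<in> spc C q"
  shows "aug r (tr C q r x) = aug q x"
proof (rule lin_map_eq_on_span[OF vector_space_axioms span_B _ aug_lin _ x])
  show "lin_map (scl C) (spc C q) (*) UNIV (\<lambda>x. aug r (tr C q r x))"
    using lin_map_compose[OF persistence_moduleD(4)[OF persistence_C qr] aug_lin] .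
  show "aug r (tr C q r b) = aug q b" if "b \<in> B q" for b
    using that tr_B[OF qr that] by (simp add: aug_B)
qed

definition aug_kernel :: "('p, 'k, 'v) pmod" where
  "aug_kernel = C\<lparr>spc := \<lambda>q. {x \<in> spc C q. aug q x = 0}\<rparr>"

definition base_line :: "('p, 'k, 'v) pmod" where
  "base_line = C\<lparr>spc := \<lambda>q. if p \<le> q then span {base q} else {0}\<rparr>"

definition diff_basis :: "'p \<Rightarrow> 'v set" where
  "diff_basis q = (\<lambda>b. b - base q) ` (B q - {base q})"

lemma aug_kernel_simps [simp]:
  "scl aug_kernel = scl C" "tr aug_kernel = tr C"
  "spc aug_kernel q = {x \<in> spc C q. aug q x = 0}"
  by (simp_all add: aug_kernel_def)

lemma base_line_simps [simp]:
  "scl base_line = scl C" "tr base_line = tr C"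
  "spc base_line q = (if p \<le> q then span {base q} else {0})"
  by (simp_all add: base_line_def)

lemma span_base_subset: "p \<le> q \<Longrightarrow> span {base q} \<subseteq> spc C q"
  using span_mono[of "{base q}" "B q"] base_B span_B by simp

lemma interval_basis_base_line: "interval_basis base_line p base"
proof -
  have tr_in: "tr C q r x \<in> spc base_line r" if qr: "q \<le> r" and x: "x \<in> spc base_line q" for q r x
  proof (cases "p \<le> q")
    case True
    then obtain k where k: "x = scl C k (base q)" using x span_singleton[of "base q"] by auto
    have pr: "p \<le> r" using True qr by simp
    have "tr C q r x = scl C k (base r)"
      using lin_mapD(3)[OF persistence_moduleD(4)[OF persistence_C qr] base_spc[OF True]] tr_base[OF True qr] k
      by simp
    then show ?thesis using pr span_scale[OF span_base, of "base r" "{base r}"] by simp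
  next
    case False
    then have "x = 0" using x by simp
    then show ?thesis using persistence_module_closed(6)[OF persistence_C qr] span_zero by simp
  qed
  have "persistence_module base_line"
    unfolding base_line_def
  proof (rule persistence_submodule[OF persistence_C])
    fix q
    show "subspace (if p \<le> q then span {base q} else {0})" by (simp add: subspace_span subspace_single_0)
    show "(if p \<le> q then span {base q} else {0}) \<subseteq> spc C q"
      using span_base_subset persistence_module_closed(1)[OF persistence_C] by simp
    show "\<exists>A. finite A \<and> span A = (if p \<le> q then span {base q} else {0})"
      by (rule exI[of _ "if p \<le> q then {base q} else {}"]) simp
  qed (use tr_in in simp)
  moreover have "base q \<noteq> 0" if "p \<le> q" for q
    using base_B[OF that] independent_B dependent_zero by metis
  ultimately show ?thesis
    using tr_base by (simp add: interval_basis_def)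
qed

lemma remove_aug:
  assumes x: "x \<in> spc C q"
  shows "x - scl C (aug q x) (base q) = (\<Sum>b\<in>B q. scl C (representation (B q) x b) (b - base q))"
proof -
  have "(\<Sum>b\<in>B q. scl C (representation (B q) x b) b) = x"
    using sum_representation_eq[OF independent_B _ finite_B subset_refl] x span_B by blast
  then show ?thesis
    by (simp add: scale_right_diff_distrib sum_subtractf aug_def scale_sum_left)
qed

lemma diff_basis_aug_kernel: "c \<in> diff_basis q \<Longrightarrow> c \<in> spc aug_kernel q"
proof -
  assume c: "c \<in> diff_basis q"
  then obtain b where b: "b \<in> B q" "c = b - base q" by (auto simp: diff_basis_def)
  have pq: "p \<le> q" using above b(1) .
  show ?thesis
    using aug_diff[OF B_spc[OF b(1)] base_spc[OF pq]] b pq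
      persistence_module_closed(3)[OF persistence_C B_spc[OF b(1)] base_spc[OF pq]]
    by (simp add: aug_B base_B)
qed

lemma subspace_aug_kernel: "subspace (spc aug_kernel q)"
proof (rule subspaceI)
  show "0 \<in> spc aug_kernel q"
    using lin_map_zero[OF aug_lin] persistence_module_closed(1)[OF persistence_C] by simp
qed (use persistence_module_closed(2,4)[OF persistence_C] aug_add aug_scale in simp_all)

lemma span_diff_basis: "span (diff_basis q) = spc aug_kernel q"
proof
  show "span (diff_basis q) \<subseteq> spc aug_kernel q"
    using diff_basis_aug_kernel by (intro span_minimal subspace_aug_kernel) blast
  show "spc aug_kernel q \<subseteq> span (diff_basis q)"
  proof
    fix x assume "x \<in> spc aug_kernel q"
    then have "x = (\<Sum>b\<in>B q. scl C (representation (B q) x b) (b - base q))"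
      using remove_aug[of x q] by simp
    moreover have "scl C k (b - base q) \<in> span (diff_basis q)" if "b \<in> B q" for b k
    proof (cases "b = base q")
      case True then show ?thesis by (simp add: span_zero)
    next
      case False
      then have "b - base q \<in> diff_basis q" using that by (simp add: diff_basis_def)
      then show ?thesis by (intro span_scale span_base)
    qed
    ultimately show "x \<in> span (diff_basis q)" by (metis (no_types, lifting) span_sum)
  qed
qed

text \<open>
  The coordinate at \<open>b \<noteq> base q\<close> in the basis \<open>B q\<close> is 1 on \<open>b - base q\<close> and 0 on all other elements of
  \<open>diff_basis q\<close>.
\<close>

lemma independent_diff_basis: "independent (diff_basis q)"
proof
  assume "dependent (diff_basis q)"
  then obtain c where c: "c \<in> diff_basis q" "c \<in> span (diff_basis q - {c})"
    unfolding dependent_def by blast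
  obtain b where b: "b \<in> B q" "b \<noteq> base q" "c = b - base q"
    using c(1) by (auto simp: diff_basis_def)
  have pq: "p \<le> q" using above b(1) .
  let ?K = "{x \<in> spc C q. representation (B q) x b = 0}"
  have coord: "representation (B q) (b' - base q) b = (if b = b' then 1 else 0)" if "b' \<in> B q" for b'
    using lin_map_diff[OF repr_lin persistence_moduleD(1,2)[OF persistence_C] B_spc[OF that] base_spc[OF pq]]
      that b(2) base_B[OF pq] by (simp add: repr_B)
  have "subspace ?K"
  proof (rule subspaceI)
    show "0 \<in> ?K" using lin_map_zero[OF repr_lin] persistence_module_closed(1)[OF persistence_C] by simp
  qed (use persistence_module_closed(2,4)[OF persistence_C] lin_mapD(2,3)[OF repr_lin] in simp_all)
  moreover have "diff_basis q - {c} \<subseteq> ?K"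
  proof
    fix d assume d: "d \<in> diff_basis q - {c}"
    then obtain b' where "b' \<in> B q" "d = b' - base q" by (auto simp: diff_basis_def)
    then show "d \<in> ?K" using d b(3) coord diff_basis_aug_kernel[of d q] by auto
  qed
  ultimately have "c \<in> ?K" using span_minimal c(2) by blast
  then show False using coord[OF b(1)] b(3) by simp
qed

lemma tr_diff:
  assumes qr: "q \<le> r" and b: "b \<in> B q"
  shows "tr C q r (b - base q) = tr C q r b - base r"
proof -
  have pq: "p \<le> q" using above b .
  show ?thesis
    using lin_map_diff[OF persistence_moduleD(4)[OF persistence_C qr] persistence_moduleD(1,2)[OF persistence_C]
        B_spc[OF b] base_spc[OF pq]] tr_base[OF pq qr] by simp
qed

lemma persistence_module_aug_kernel: "persistence_module aug_kernel"
  unfolding aug_kernel_def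
proof (rule persistence_submodule[OF persistence_C])
  fix q
  show "subspace {x \<in> spc C q. aug q x = 0}" using subspace_aug_kernel[of q] by simp
  show "\<exists>A. finite A \<and> span A = {x \<in> spc C q. aug q x = 0}"
    using span_diff_basis[of q] finite_B[of q] by (intro exI[of _ "diff_basis q"]) (simp add: diff_basis_def)
qed (auto simp: aug_tr persistence_module_closed[OF persistence_C])

lemma repr_diff_basis:
  "c \<in> diff_basis q \<Longrightarrow> representation (diff_basis q) c d = (if d = c then 1 else 0)"
  using representation_basis[OF independent_diff_basis] by simp

lemma entry_diff_basis:
  assumes qr: "q \<le> r" and b: "b \<in> B q"
  shows "entry aug_kernel diff_basis q r c (b - base q) =
    (if tr C q r b \<noteq> base r \<and> c = tr C q r b - base r then 1 else 0)"
proof (cases "tr C q r b = base r")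
  case True
  then show ?thesis by (simp add: entry_def tr_diff[OF qr b] representation_zero)
next
  case False
  then have "tr C q r b - base r \<in> diff_basis r"
    using tr_B[OF qr b] by (simp add: diff_basis_def)
  then show ?thesis using False by (simp add: entry_def tr_diff[OF qr b] repr_diff_basis)
qed

text \<open>
  The vector \<open>b - base q\<close> goes to \<open>tr C q r b - base r\<close>, which is either again in the basis or
  zero, the latter if \<open>b\<close> is merged with \<open>base\<close> between \<open>q\<close> and \<open>r\<close>.
\<close>

lemma semi_component_basis_diff_basis: "semi_component_basis aug_kernel diff_basis"
  unfolding semi_component_basis_def
proof (intro conjI allI impI ballI)
  show "persistence_module aug_kernel" by (rule persistence_module_aug_kernel)
  show "basis_family aug_kernel diff_basis"
    using independent_diff_basis span_diff_basis by (simp add: basis_family_def)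
  fix q r c assume qr: "q \<le> r" and "c \<in> diff_basis q"
  then obtain b where b: "b \<in> B q" "c = b - base q" by (auto simp: diff_basis_def)
  show "entry aug_kernel diff_basis q r d c \<in> {0, 1}" for d
    using entry_diff_basis[OF qr b(1)] b(2) by simp
  show "\<exists>\<^sub>\<le>\<^sub>1 d. d \<in> diff_basis r \<and> entry aug_kernel diff_basis q r d c = 1"
    using entry_diff_basis[OF qr b(1)] b(2) by (auto simp: Uniq_def split: if_splits)
qed

lemma base_multiple_spc: "p \<le> q \<Longrightarrow> scl C k (base q) \<in> spc C q"
  using persistence_module_closed(4)[OF persistence_C] base_spc by blast

lemma aug_base_multiple: "p \<le> q \<Longrightarrow> aug q (scl C k (base q)) = k"
  using aug_scale[OF base_spc] aug_B[OF base_B] by simp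

lemma remove_aug_in_kernel:
  assumes pq: "p \<le> q" and x: "x \<in> spc C q"
  shows "x - scl C (aug q x) (base q) \<in> spc aug_kernel q"
  using aug_diff[OF x base_multiple_spc[OF pq]] aug_base_multiple[OF pq]
    persistence_module_closed(3)[OF persistence_C x base_multiple_spc[OF pq]] by simp

lemma tr_remove_aug:
  assumes pq: "p \<le> q" and qr: "q \<le> r" and x: "x \<in> spc C q"
  shows "tr C q r (scl C (aug q x) (base q)) = scl C (aug r (tr C q r x)) (base r)"
    and "tr C q r (x - scl C (aug q x) (base q)) =
      tr C q r x - scl C (aug r (tr C q r x)) (base r)"
proof -
  note lin = persistence_moduleD(4)[OF persistence_C qr]
  show "tr C q r (scl C (aug q x) (base q)) = scl C (aug r (tr C q r x)) (base r)"
    using lin_mapD(3)[OF lin base_spc[OF pq]] tr_base[OF pq qr] aug_tr[OF qr x] by simp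
  then show "tr C q r (x - scl C (aug q x) (base q)) =
      tr C q r x - scl C (aug r (tr C q r x)) (base r)"
    using lin_map_diff[OF lin persistence_moduleD(1,2)[OF persistence_C] x base_multiple_spc[OF pq]] by simp
qed

lemma spc_zero_cases: "x \<in> spc C q \<Longrightarrow> p \<le> q \<or> x = 0"
  using spc_eq_zero_iff by blast

lemma iso_sum_aug_kernel_base_line: "pmod_iso C (pmod_sum aug_kernel base_line)"
proof -
  let ?f = "\<lambda>q x. (x - scl C (aug q x) (base q), scl C (aug q x) (base q))"
  let ?N = "pmod_sum aug_kernel base_line"
  have aug0: "aug q 0 = 0" for q
    using lin_map_zero[OF aug_lin] persistence_module_closed(1)[OF persistence_C] .
  have "pmod_hom C ?N ?f"
    unfolding pmod_hom_def
  proof (intro conjI allI impI ballI)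
    fix q
    have mem: "?f q x \<in> spc ?N q" if "x \<in> spc C q" for x
      using spc_zero_cases[OF that]
    proof
      assume pq: "p \<le> q"
      then show ?thesis
        using remove_aug_in_kernel[OF pq that] span_scale[OF span_base, of "base q" "{base q}"]
        by simp
    next
      assume "x = 0"
      then show ?thesis
        using persistence_module_closed(1)[OF persistence_C] span_zero by (simp add: aug0)
    qed
    show "lin_map (scl C) (spc C q) (scl ?N) (spc ?N q) (?f q)"
      unfolding lin_map_def
      using mem aug_add[of _ q] aug_scale[of _ q]
      by (simp add: scale_left_distrib scale_right_diff_distrib)
  next
    fix q r x assume qr: "q \<le> r" and x: "x \<in> spc C q"
    show "?f r (tr C q r x) = tr ?N q r (?f q x)"
      using spc_zero_cases[OF x]
    proof
      assume pq: "p \<le> q"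
      then show ?thesis using tr_remove_aug[OF pq qr x] by simp
    next
      assume "x = 0"
      then show ?thesis by (simp add: aug0 persistence_module_closed(6)[OF persistence_C qr])
    qed
  qed
  moreover have "bij_betw (?f q) (spc C q) (spc ?N q)" for q
  proof (rule bij_betw_byWitness[where f' = "\<lambda>(x, y). x + y"])
    show "?f q ` spc C q \<subseteq> spc ?N q"
      using pmod_hom_maps[OF \<open>pmod_hom C ?N ?f\<close>] by blast
    have y: "y \<in> spc C q" "scl C (aug q y) (base q) = y" if line: "y \<in> spc base_line q" for y
    proof -
      have "y \<in> spc C q \<and> scl C (aug q y) (base q) = y"
      proof (cases "p \<le> q")
        case True
        then obtain k where "y = scl C k (base q)" using line span_singleton[of "base q"] by auto
        then show ?thesis using aug_base_multiple[OF True] base_multiple_spc[OF True] by simp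
      next
        case False
        then show ?thesis using line persistence_module_closed(1)[OF persistence_C] by (simp add: aug0)
      qed
      then show "y \<in> spc C q" "scl C (aug q y) (base q) = y" by simp_all
    qed
    show "\<forall>z\<in>spc ?N q. ?f q (case z of (x, y) \<Rightarrow> x + y) = z"
    proof
      fix z assume "z \<in> spc ?N q"
      then obtain u v where z: "z = (u, v)" "u \<in> spc C q" "aug q u = 0" "v \<in> spc base_line q"
        by auto
      have "aug q (u + v) = aug q v" using aug_add[OF z(2) y(1)[OF z(4)]] z(3) by simp
      then show "?f q (case z of (x, y) \<Rightarrow> x + y) = z" using y(2)[OF z(4)] z(1) by simp
    qed
    show "(\<lambda>(x, y). x + y) ` spc ?N q \<subseteq> spc C q"
      using persistence_module_closed(2)[OF persistence_C] y(1) by auto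
  qed simp
  ultimately show ?thesis using pmod_isoI[OF pmod_inverse_inv_into[OF persistence_C]] by blast
qed

text \<open>
  In the change of basis below, \<open>base q\<close> corresponds to \<open>(1, 0)\<close> and every other basis vector \<open>b\<close>
  to \<open>(0, b - base q)\<close>.  A column of \<open>aug_kernel\<close> contains no 1 exactly if \<open>b\<close> is merged with \<open>base\<close>,
  and then \<open>b\<close> is indeed sent to the added vector; this is the entry 1 in the new first row.
\<close>

lemma extension_basis_map:
  assumes pq: "p \<le> q" and qr: "q \<le> r" and b: "b \<in> B q"
  shows "tr (component_extension aug_kernel diff_basis p) q r
           (representation (B q) b (base q), b - base q) =
         (representation (B r) (tr C q r b) (base r), tr C q r b - base r)"
proof (cases "b = base q")
  case True
  then show ?thesis
    using base_B[OF pq] base_B[of r] pq qr tr_base[OF pq qr] persistence_module_closed(6)[OF persistence_C qr]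
    by (simp add: component_extension_simps repr_B representation_zero)
next
  case False
  then have c: "b - base q \<in> diff_basis q" using b by (simp add: diff_basis_def)
  have "finite (diff_basis q)" using finite_B by (simp add: diff_basis_def)
  then have sum: "(\<Sum>c\<in>diff_basis q. new_row aug_kernel diff_basis q r c *
      representation (diff_basis q) (b - base q) c) = new_row aug_kernel diff_basis q r (b - base q)"
    using c by (simp add: repr_diff_basis[OF c] if_distrib cong: if_cong)
  have "tr C q r b \<noteq> base r \<Longrightarrow> tr C q r b - base r \<in> diff_basis r"
    using tr_B[OF qr b] by (simp add: diff_basis_def)
  then have "new_row aug_kernel diff_basis q r (b - base q) = (if tr C q r b = base r then 1 else 0)"
    unfolding new_row_def entry_diff_basis[OF qr b] by auto
  then show ?thesis
    using sum b False tr_B[OF qr b] tr_diff[OF qr b]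
    by (simp add: component_extension_simps repr_B)
qed

text \<open>
  The isomorphism extends the change of basis linearly: the first coordinate of \<open>x\<close> is its coefficient
  at \<open>base q\<close>, not its augmentation.  The inverse restores to \<open>v\<close> the multiple of \<open>base q\<close> that makes
  this coefficient equal to \<open>a\<close>.
\<close>

lemma is_component_extension_aug_kernel: "is_component_extension C aug_kernel diff_basis p"
proof -
  let ?E = "component_extension aug_kernel diff_basis p"
  let ?f = "\<lambda>q x. (representation (B q) x (base q), x - scl C (aug q x) (base q))"
  have f0: "?f q 0 = 0" for q
    using lin_map_zero[OF aug_lin] persistence_module_closed(1)[OF persistence_C]
    by (simp add: representation_zero zero_prod_def)
  have mem: "?f q x \<in> spc ?E q" if "x \<in> spc C q" for q x
  proof (cases "p \<le> q")
    case True
    then show ?thesis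
      using remove_aug_in_kernel[OF True that] by (simp add: component_extension_simps)
  next
    case False
    then show ?thesis
      using that spc_zero_cases[OF that] f0 by (simp add: component_extension_simps)
  qed
  have lin: "lin_map (scl C) (spc C q) (scl ?E) (spc ?E q) (?f q)" for q
    unfolding lin_map_def
    using mem lin_mapD(2,3)[OF repr_lin[of q]] aug_add[of _ q] aug_scale[of _ q]
    by (simp add: component_extension_simps scale_left_distrib scale_right_diff_distrib)
  have nat: "?f r (tr C q r x) = tr ?E q r (?f q x)" if qr: "q \<le> r" and x: "x \<in> spc C q" for q r x
    using spc_zero_cases[OF x]
  proof
    assume pq: "p \<le> q"
    have aug_basis: "?f q b = (representation (B q) b (base q), b - base q)" if "b \<in> B q" for q b
      using that by (simp add: aug_B)
    have trE: "lin_map (scl ?E) (spc ?E q) (scl ?E) (spc ?E r) (tr ?E q r)"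
      using lin_map_component_extension_tr[OF semi_component_basis_diff_basis pq qr] .
    show ?thesis
    proof (rule lin_map_eq_on_span[OF vector_space_axioms span_B _ _ _ x])
      show "lin_map (scl C) (spc C q) (scl ?E) (spc ?E r) (\<lambda>x. ?f r (tr C q r x))"
        by (rule lin_map_compose[OF persistence_moduleD(4)[OF persistence_C qr] lin])
      show "lin_map (scl C) (spc C q) (scl ?E) (spc ?E r) (\<lambda>x. tr ?E q r (?f q x))"
        by (rule lin_map_compose[OF lin trE])
      show "?f r (tr C q r b) = tr ?E q r (?f q b)" if "b \<in> B q" for b
        using extension_basis_map[OF pq qr that] aug_basis[OF that] aug_basis[OF tr_B[OF qr that]]
        by simp
    qed
  next
    assume "x = 0"
    moreover have "tr ?E q r 0 = 0"
      by (simp add: component_extension_simps zero_prod_def representation_zero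
          persistence_module_closed(6)[OF persistence_C qr])
    ultimately show ?thesis using f0 persistence_module_closed(6)[OF persistence_C qr] by simp
  qed
  have hom: "pmod_hom C ?E ?f" using lin nat by (simp add: pmod_hom_def)
  have "bij_betw (?f q) (spc C q) (spc ?E q)" for q
  proof (cases "p \<le> q")
    case False
    then have "spc C q = {0}" using spc_eq_zero_iff by simp
    then show ?thesis using False f0 by (simp add: bij_betw_def component_extension_simps)
  next
    case True
    note subC = persistence_moduleD(1,2)[OF persistence_C]
    have base_coord: "representation (B q) (scl C k (base q)) (base q) = k" for k
      using lin_mapD(3)[OF repr_lin base_spc[OF True]] repr_B[OF base_B[OF True]] by simp
    let ?h = "\<lambda>(a, v). v + scl C (a - representation (B q) v (base q)) (base q)"
    show ?thesis
    proof (rule bij_betw_byWitness[where f' = ?h])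
      show "\<forall>x\<in>spc C q. ?h (?f q x) = x"
        using lin_map_diff[OF repr_lin subC _ base_multiple_spc[OF True]] base_coord by simp
      show "?f q ` spc C q \<subseteq> spc ?E q" using mem by blast
      have memh: "v + scl C k (base q) \<in> spc C q" if "v \<in> spc C q" for v k
        using persistence_module_closed(2)[OF persistence_C that base_multiple_spc[OF True]] .
      then show "?h ` spc ?E q \<subseteq> spc C q" using True by (auto simp: component_extension_simps)
      show "\<forall>z\<in>spc ?E q. ?f q (?h z) = z"
      proof
        fix z assume "z \<in> spc ?E q"
        then obtain a v where z: "z = (a, v)" "v \<in> spc C q" "aug q v = 0"
          using True by (auto simp: component_extension_simps)
        let ?k = "a - representation (B q) v (base q)"
        have "representation (B q) (v + scl C ?k (base q)) (base q) = a"
          using lin_mapD(2)[OF repr_lin z(2) base_multiple_spc[OF True]] base_coord by simp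
        moreover have "aug q (v + scl C ?k (base q)) = ?k"
          using aug_add[OF z(2) base_multiple_spc[OF True]] aug_base_multiple[OF True] z(3) by simp
        ultimately show "?f q (?h z) = z" using z(1) by simp
      qed
    qed
  qed
  then have "pmod_iso C ?E" using pmod_isoI[OF pmod_inverse_inv_into[OF persistence_C hom]] by blast
  moreover have "p \<le> q" if "generator aug_kernel diff_basis q c" for q c
    using that above by (auto simp: generator_def diff_basis_def)
  moreover have "spc aug_kernel q = {0}" if "\<not> p \<le> q" for q
    using that spc_eq_zero_iff[of q] lin_map_zero[OF aug_lin[of q]] by auto
  ultimately show ?thesis
    using semi_component_basis_diff_basis by (simp add: is_component_extension_def)
qed

end

section \<open>Existence and uniqueness of the splitting\<close>

theorem corollary5p11:
  fixes C :: "('p::order, 'k::field, 'v::ab_group_add) pmod"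
    and B :: "'p \<Rightarrow> 'v set"
    and p :: 'p
  assumes comp: "component_basis C B"
    and min: "minimal_generator_position C B p"
    and ungenerated: "\<And>q b. b \<in> B q \<Longrightarrow> \<not> from_generator C B q b \<Longrightarrow> p \<le> q"
  shows "\<exists>(S :: ('p, 'k, 'v) pmod) (I :: ('p, 'k, 'v) pmod).
           semi_component_module S \<and> interval_module I \<and> pmod_iso C (pmod_sum S I) \<and>
           (\<forall>q. iso_field_at I q \<longleftrightarrow> p \<le> q) \<and>
           (\<exists>BS. is_component_extension C S BS p) \<and>
           (\<forall>(S' :: ('p, 'k, 's::ab_group_add) pmod) (I' :: ('p, 'k, 'i::ab_group_add) pmod).
              semi_component_module S' \<and> interval_module I' \<and> pmod_iso C (pmod_sum S' I') \<and>
              ((\<forall>q. iso_field_at I' q \<longleftrightarrow> p \<le> q) \<or> (\<exists>BS' p'. is_component_extension C S' BS' p'))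
              \<longrightarrow> pmod_iso S' S \<and> pmod_iso I' I)"
proof -
  obtain g where g: "generator C B p g"
    using min unfolding minimal_generator_position_def by blast
  have least: "p \<le> r" if "generator C B r h" for r h
    using min that unfolding minimal_generator_position_def by blast
  have above: "p \<le> q" if "b \<in> B q" for q b
  proof (cases "from_generator C B q b")
    case True
    then obtain r h where "r \<le> q" "generator C B r h"
      unfolding from_generator_def by blast
    then show ?thesis using least order_trans by blast
  next
    case False
    then show ?thesis using ungenerated that by blast
  qed
  interpret pointed_component_module C B p g
    using comp g above by unfold_locales (auto simp: generator_def)
  note line = interval_basis_base_line
  have unique: "pmod_iso S' aug_kernel \<and> pmod_iso I' base_line"
    if S': "semi_component_module S'" and I': "interval_module I'"
      and sum: "pmod_iso C (pmod_sum S' I')"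
      and alt: "(\<forall>q. iso_field_at I' q \<longleftrightarrow> p \<le> q) \<or> (\<exists>BS' p'. is_component_extension C S' BS' p')"
    for S' :: "('p, 'k, 's) pmod" and I' :: "('p, 'k, 'i) pmod"
  proof -
    have "iso_field_at I' q \<longleftrightarrow> p \<le> q" for q
      using alt
    proof
      assume "\<exists>BS' p'. is_component_extension C S' BS' p'"
      then obtain BS' p' where "is_component_extension C S' BS' p'" by blast
      then show ?thesis
        by (rule interval_support_if_component_extension[OF persistence_C spc_eq_zero_iff sum I'])
    qed blast
    then obtain e where e: "interval_basis I' p e"
      using interval_module_obtains_basis[OF I'] by blast
    have "persistence_module S'"
      using S' unfolding semi_component_module_def semi_component_basis_def by blast
    from cancel_interval[OF persistence_C iso_sum_aug_kernel_base_line sum persistence_module_aug_kernel this line e]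
    show ?thesis by simp
  qed
  show ?thesis
  proof (rule exI[of _ aug_kernel], rule exI[of _ base_line], intro conjI allI impI)
    show "semi_component_module aug_kernel"
      using semi_component_basis_diff_basis unfolding semi_component_module_def by blast
    show "interval_module base_line" by (rule interval_module_interval_basis[OF line])
    show "pmod_iso C (pmod_sum aug_kernel base_line)" by (rule iso_sum_aug_kernel_base_line)
    show "iso_field_at base_line q \<longleftrightarrow> p \<le> q" for q by (rule iso_field_at_interval_basis[OF line])
    show "\<exists>BS. is_component_extension C aug_kernel BS p"
      using is_component_extension_aug_kernel by blast
  qed (use unique in blast)+
qed

end
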